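(* There exists a separable compact line $K$ of weight $2^{\omega}$ such that the Banach space $C(K)$ is not isomorphic to $C(K)\times C(K)$.
   Context: A compact line is a linearly ordered set whose order topology is compact, regarded as a topological space. $C(K)$ is the Banach space of continuous real-valued functions on $K$ with the supremum norm. Isomorphic means linearly homeomorphic. The result is in $\mathsf{ZFC}$. *)

theory Defs
  imports "HOL-Analysis.Analysis"
begin

unbundle cardinal_syntax
no_notation elt_set_eq (infix \<open>=o\<close> 50)

text \<open>The carrier itself is a subbasic set because the open rays alone do not cover a one-point
  line.\<close>

definition line_topology :: "'a set \<Rightarrow> 'a rel \<Rightarrow> 'a topology" where
  "line_topology K r =
     topology_generated_by (insert K ((\<lambda>a. K \<inter> underS r a) ` K \<union> (\<lambda>a. K \<inter> aboveS r a) ` K))"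

definition compact_line :: "'a set \<Rightarrow> 'a rel \<Rightarrow> bool" where
  "compact_line K r \<longleftrightarrow> linear_order_on K r \<and> compact_space (line_topology K r)"

definition base_of :: "'a topology \<Rightarrow> 'a set set \<Rightarrow> bool" where
  "base_of X \<B> \<longleftrightarrow> openin X = arbitrary union_of (\<lambda>U. U \<in> \<B>)"

text \<open>The weight is the least cardinality of a base; cardinals are compared up to \<open>=o\<close>, so it is
  given as a relation. No \<open>\<omega>\<close> is added for spaces with a finite base.\<close>

definition has_weight :: "'a topology \<Rightarrow> 'c rel \<Rightarrow> bool" where
  "has_weight X \<kappa> \<longleftrightarrow>
     (\<exists>\<B>. base_of X \<B> \<and> |\<B>| =o \<kappa>) \<and> (\<forall>\<B>. base_of X \<B> \<longrightarrow> \<kappa> \<le>o |\<B>| )"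

text \<open>A real vector space with a metric; its carrier is the \<open>mspace\<close> of the metric.\<close>

record 'v metric_vs =
  vmetric :: "'v metric"
  vadd :: "'v \<Rightarrow> 'v \<Rightarrow> 'v"
  vscale :: "real \<Rightarrow> 'v \<Rightarrow> 'v"

text \<open>For compact \<open>X\<close> the boundedness built into \<^const>\<open>cfunspace\<close> is automatic, and its metric is
  the one induced by the supremum norm. Elements are functions that are \<open>undefined\<close> off
  \<open>topspace X\<close>, hence the restrictions in the pointwise operations.\<close>

definition C_space :: "'a topology \<Rightarrow> ('a \<Rightarrow> real) metric_vs" where
  "C_space X =
     \<lparr>vmetric = cfunspace X euclidean_metric,
      vadd = (\<lambda>f g. \<lambda>x\<in>topspace X. f x + g x),
      vscale = (\<lambda>c f. \<lambda>x\<in>topspace X. c * f x)\<rparr>"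

definition prod_vs :: "'v metric_vs \<Rightarrow> 'w metric_vs \<Rightarrow> ('v \<times> 'w) metric_vs" where
  "prod_vs V W =
     \<lparr>vmetric = prod_metric (vmetric V) (vmetric W),
      vadd = (\<lambda>p q. (vadd V (fst p) (fst q), vadd W (snd p) (snd q))),
      vscale = (\<lambda>c p. (vscale V c (fst p), vscale W c (snd p)))\<rparr>"

definition linear_map_vs :: "'v metric_vs \<Rightarrow> 'w metric_vs \<Rightarrow> ('v \<Rightarrow> 'w) \<Rightarrow> bool" where
  "linear_map_vs V W T \<longleftrightarrow>
     (\<forall>u \<in> mspace (vmetric V). \<forall>v \<in> mspace (vmetric V). T (vadd V u v) = vadd W (T u) (T v)) \<and>
     (\<forall>c. \<forall>v \<in> mspace (vmetric V). T (vscale V c v) = vscale W c (T v))"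

definition linearly_homeomorphic :: "'v metric_vs \<Rightarrow> 'w metric_vs \<Rightarrow> bool" where
  "linearly_homeomorphic V W \<longleftrightarrow>
     (\<exists>T. linear_map_vs V W T \<and>
          homeomorphic_map (mtopology_of (vmetric V)) (mtopology_of (vmetric W)) T)"

end

theory Submission
  imports Defs
begin

text \<open>
  Let \<open>A\<close> be a dense subset of the open unit interval, and let \<open>K\<close> be \<open>[0, 1]\<close> with each point \<open>a\<close> of
  \<open>A\<close> split into two neighbours \<open>a < a\<^sup>+\<close>. This is a compact line in which the rationals are dense.
  For \<open>a \<in> A\<close> the clopen set of the points up to \<open>a\<close> has maximum \<open>a\<close>, so every base has at least \<open>|A|\<close>
  members. Write \<open>\<chi>\<^sub>a\<close> for its indicator and \<open>J\<^sub>b f = f b - f b\<^sup>+\<close> for the jump of \<open>f\<close> at \<open>b \<in> A\<close>. The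
  linear combinations of \<open>1\<close> and the \<open>\<chi>\<^sub>a\<close> are dense in \<open>C(K)\<close> (\<open>step_dense\<close>), whence each
  continuous function has only countably many nonzero jumps (\<open>countable_jumps\<close>).

  The space \<open>C(K)\<close> differs from its square if \<open>A\<close> has continuum many points and operators barely move
  jumps: for each bounded operator \<open>S\<close> on \<open>C(K)\<close>, all but fewer than continuum many \<open>b \<in> A\<close> satisfy
  \<open>J\<^sub>b (S \<chi>\<^sub>a) = 0\<close> for all \<open>a \<in> A - {b}\<close> (\<open>few_moved_jumps\<close>). Given this, let \<open>T = (T\<^sub>1, T\<^sub>2)\<close> be an
  isomorphism onto the square. Some \<open>b \<in> A\<close> is good for \<open>T\<^sub>1\<close> and \<open>T\<^sub>2\<close> at once and has
  \<open>J\<^sub>b (T\<^sub>i 1) = 0\<close>; by density \<open>J\<^sub>b \<circ> T\<^sub>1\<close> and \<open>J\<^sub>b \<circ> T\<^sub>2\<close> are then both multiples of \<open>J\<^sub>b\<close>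
  (\<open>functional_eq_jump\<close>). Two proportional functionals contradict the surjectivity of \<open>T\<close>
  (\<open>not_isomorphic_to_square\<close>).

  It remains to choose \<open>A\<close>, by transfinite diagonalisation. For each rational \<open>q\<close> the function
  \<open>a \<mapsto> S \<chi>\<^sub>a q\<close> on \<open>A\<close> has bounded variation, so it can be recovered from its values on a countable set
  (\<open>functional_cut_coded\<close>). Hence all operators on all the spaces \<open>C(K)\<close> in question are described by
  continuum many codes. If \<open>S\<close> violated the condition above, then, as every \<open>S \<chi>\<^sub>a\<close> has only countably
  many jumps, no set of fewer than continuum many points would meet all pairs \<open>a \<noteq> b\<close> such that
  \<open>S \<chi>\<^sub>a\<close> has no limit at \<open>b\<close> along the rationals. The recursion (\<open>diagonal\<close>) meets each code of this kind
  at a stage where fewer than continuum many points have been decided, so it can pick an undecided pair,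
  put \<open>a\<close> into \<open>A\<close> and keep \<open>b\<close> out of \<open>A\<close>. This rules the operator out: \<open>S \<chi>\<^sub>a\<close> is continuous on \<open>K\<close>, and
  \<open>b\<close> has not been split, so the limit at \<open>b\<close> exists.
\<close>

section \<open>The split interval\<close>

text \<open>The unit interval itself serves as the lower copy, and the upper twin of \<open>a \<in> A\<close> is the real number
  \<open>a + 2\<close>. Then \<open>loc\<close> is the projection onto the unit interval, and the lexicographic order on twins
  compares projections first and then the real numbers themselves. It is a linear order on all of
  \<^typ>\<open>real\<close>.\<close>

definition loc :: "real \<Rightarrow> real" where
  "loc x = (if x \<le> 1 then x else x - 2)"

definition prec :: "real \<Rightarrow> real \<Rightarrow> bool" (infix "\<sqsubset>" 50) where
  "x \<sqsubset> y \<longleftrightarrow> loc x < loc y \<or> loc x = loc y \<and> x < y"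

definition preceq :: "real \<Rightarrow> real \<Rightarrow> bool" (infix "\<sqsubseteq>" 50) where
  "x \<sqsubseteq> y \<longleftrightarrow> loc x < loc y \<or> loc x = loc y \<and> x \<le> y"

lemma preceq_iff: "x \<sqsubseteq> y \<longleftrightarrow> x \<sqsubset> y \<or> x = y"
  by (auto simp: prec_def preceq_def)

lemma not_preceq_iff [simp]: "\<not> x \<sqsubseteq> y \<longleftrightarrow> y \<sqsubset> x"
  by (auto simp: prec_def preceq_def)

lemma not_prec_iff [simp]: "\<not> x \<sqsubset> y \<longleftrightarrow> y \<sqsubseteq> x"
  by (auto simp: prec_def preceq_def)

lemma prec_irrefl [simp]: "\<not> x \<sqsubset> x" "x \<sqsubseteq> x"
  by (auto simp: prec_def preceq_def)

lemma prec_trans: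
  "x \<sqsubset> y \<Longrightarrow> y \<sqsubset> z \<Longrightarrow> x \<sqsubset> z" "x \<sqsubseteq> y \<Longrightarrow> y \<sqsubset> z \<Longrightarrow> x \<sqsubset> z"
  "x \<sqsubset> y \<Longrightarrow> y \<sqsubseteq> z \<Longrightarrow> x \<sqsubset> z" "x \<sqsubseteq> y \<Longrightarrow> y \<sqsubseteq> z \<Longrightarrow> x \<sqsubseteq> z"
  by (auto simp: prec_def preceq_def)

definition cut :: "real \<Rightarrow> real \<Rightarrow> real" where
  "cut a x = (if x \<sqsubseteq> a then 1 else 0)"

locale split_interval =
  fixes A :: "real set"
  assumes A_subset: "A \<subseteq> {0<..<1}"
    and A_dense: "\<And>x y. 0 \<le> x \<Longrightarrow> x < y \<Longrightarrow> y \<le> 1 \<Longrightarrow> \<exists>a\<in>A. x < a \<and> a < y"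
begin

definition K :: "real set" where
  "K = {0..1} \<union> (\<lambda>a. a + 2) ` A"

definition ord :: "real rel" where
  "ord = {(x, y). x \<in> K \<and> y \<in> K \<and> x \<sqsubseteq> y}"

definition X :: "real topology" where
  "X = line_topology K ord"

lemma A_bounds: "a \<in> A \<Longrightarrow> 0 < a \<and> a < 1"
  using A_subset by auto

lemma loc_A [simp]: "a \<in> A \<Longrightarrow> loc a = a" "a \<in> A \<Longrightarrow> loc (a + 2) = a"
  using A_bounds[of a] by (auto simp: loc_def)

lemma loc_K: "x \<in> K \<Longrightarrow> 0 \<le> loc x \<and> loc x \<le> 1"
  using A_bounds by (force simp: K_def loc_def)

lemma A_in_K: "a \<in> A \<Longrightarrow> a \<in> K" "a \<in> A \<Longrightarrow> a + 2 \<in> K"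
  using A_bounds[of a] by (auto simp: K_def)

lemma twin_cases: "x \<in> K \<Longrightarrow> x = loc x \<or> x = loc x + 2 \<and> loc x \<in> A"
  using A_bounds by (force simp: K_def loc_def)

lemma unit_in_K: "0 \<le> x \<Longrightarrow> x \<le> 1 \<Longrightarrow> x \<in> K"
  by (auto simp: K_def)

text \<open>Between two points, possibly twins, there is always a splitting. For twins the lower one is the only
  choice, and this is why only one of the two relations is strict.\<close>

lemma between:
  assumes "x \<in> K" "y \<in> K" "x \<sqsubset> y"
  shows "\<exists>a\<in>A. x \<sqsubseteq> a \<and> a \<sqsubset> y"
proof (cases "loc x < loc y")
  case True
  then obtain a where "a \<in> A" "loc x < a" "a < loc y"
    using A_dense[of "loc x" "loc y"] loc_K assms by auto
  then show ?thesis by (auto simp: prec_def preceq_def)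
next
  case False
  then have eq: "loc x = loc y" "x < y" using assms by (auto simp: prec_def)
  then have "loc x \<in> A" "x = loc x" using twin_cases[of x] twin_cases[of y] assms by auto
  then show ?thesis using eq assms(3) by (metis prec_irrefl(2))
qed

lemma underS_ord: "q \<in> K \<Longrightarrow> K \<inter> underS ord q = {x\<in>K. x \<sqsubset> q}"
  by (auto simp: ord_def underS_def preceq_iff)

lemma aboveS_ord: "q \<in> K \<Longrightarrow> K \<inter> aboveS ord q = {x\<in>K. q \<sqsubset> x}"
  by (auto simp: ord_def aboveS_def preceq_iff)

definition rays :: "real set set" where
  "rays = insert K ((\<lambda>q. {x\<in>K. x \<sqsubset> q}) ` K \<union> (\<lambda>q. {x\<in>K. q \<sqsubset> x}) ` K)"

lemma X_rays: "X = topology_generated_by rays"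
proof -
  have "(\<lambda>a. K \<inter> underS ord a) ` K = (\<lambda>q. {x\<in>K. x \<sqsubset> q}) ` K"
    "(\<lambda>a. K \<inter> aboveS ord a) ` K = (\<lambda>q. {x\<in>K. q \<sqsubset> x}) ` K"
    by (auto simp: underS_ord aboveS_ord)
  then show ?thesis unfolding X_def line_topology_def rays_def by simp
qed

lemma Union_rays: "\<Union>rays = K"
  by (auto simp: rays_def)

lemma topspace_X [simp]: "topspace X = K"
  unfolding X_rays by (simp add: Union_rays)

lemma openin_rays: "U \<in> rays \<Longrightarrow> openin X U"
  unfolding X_rays by (rule topology_generated_by_Basis)

lemma linear_order_ord: "linear_order_on K ord"
proof -
  have "trans ord" by (auto simp: trans_def ord_def intro: prec_trans)
  moreover have "antisym ord" by (auto simp: antisym_def ord_def preceq_def)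
  moreover have "refl_on K ord" "total_on K ord"
    by (auto simp: refl_on_def total_on_def ord_def) (auto simp: preceq_def prec_def)
  moreover have "ord \<subseteq> K \<times> K" by (auto simp: ord_def)
  ultimately show ?thesis
    by (auto simp: linear_order_on_def partial_order_on_def preorder_on_def)
qed

text \<open>Order completeness of \<open>K\<close>: over the supremum \<open>x\<close> of the projections, the upper twin is the supremum
  exactly if it belongs to the set.\<close>

lemma supremum:
  assumes "L \<subseteq> K" "L \<noteq> {}"
  obtains s where "s \<in> K" "\<And>l. l \<in> L \<Longrightarrow> l \<sqsubseteq> s"
    "\<And>y. y \<in> K \<Longrightarrow> y \<sqsubset> s \<Longrightarrow> \<exists>l\<in>L. y \<sqsubset> l"
proof -
  define x where "x = Sup (loc ` L)"
  have bdd: "bdd_above (loc ` L)" using loc_K assms(1) by (intro bdd_aboveI[of _ 1]) auto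
  have ub: "loc l \<le> x" if "l \<in> L" for l
    unfolding x_def using that bdd by (intro cSup_upper) auto
  have lub: "\<exists>l\<in>L. z < loc l" if "z < x" for z
    using that assms(2) bdd less_cSup_iff[of "loc ` L" z] unfolding x_def by auto
  obtain l0 where l0: "l0 \<in> L" using assms(2) by auto
  have x01: "0 \<le> x" "x \<le> 1"
  proof -
    show "0 \<le> x" using ub[OF l0] loc_K[of l0] l0 assms(1) by auto
    show "x \<le> 1" unfolding x_def using loc_K assms by (intro cSup_least) auto
  qed
  show ?thesis
  proof (cases "x + 2 \<in> L")
    case True
    show ?thesis
    proof (rule that[of "x + 2"])
      show "x + 2 \<in> K" using True assms by auto
      have "loc (x + 2) = x" using x01 by (auto simp: loc_def)
      then show "l \<sqsubseteq> x + 2" if "l \<in> L" for l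
        using ub[OF that] twin_cases[of l] subsetD[OF assms(1) that] by (auto simp: preceq_def)
      show "\<exists>l\<in>L. y \<sqsubset> l" if "y \<sqsubset> x + 2" for y using that True by auto
    qed
  next
    case False
    have lx: "loc x = x" using x01 by (auto simp: loc_def)
    show ?thesis
    proof (rule that[of x])
      show "x \<in> K" using x01 by (rule unit_in_K)
      show "l \<sqsubseteq> x" if "l \<in> L" for l
        using ub[OF that] twin_cases[of l] subsetD[OF assms(1) that] that False lx
        by (auto simp: preceq_def)
      show "\<exists>l\<in>L. y \<sqsubset> l" if "y \<in> K" "y \<sqsubset> x" for y
      proof -
        have "loc y < x" using that lx twin_cases[of y] by (auto simp: prec_def)
        then show ?thesis using lub by (auto simp: prec_def)
      qed
    qed
  qed
qed

text \<open>By the Alexander subbase theorem it is enough to treat covers by rays. The supremum of the endpoints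
  of the downward rays in the cover lies in an upward ray of the cover, and this ray together with one
  downward ray covers everything.\<close>

lemma compact_X: "compact_space X"
proof (rule Alexander_subbase)
  have "generate_topology_on rays = arbitrary union_of (finite intersection_of (\<lambda>x. x \<in> rays) relative_to \<Union>rays)"
    (is "_ = ?R")
  proof (intro ext iffI)
    fix S assume S: "generate_topology_on rays S"
    have "istopology ?R" by (rule istopology_subbase)
    moreover have "?R B" if "B \<in> rays" for B
      by (metis (mono_tags, lifting) Union_upper arbitrary_union_of_inc finite_intersection_of_inc
          inf.absorb_iff2 relative_to_inc that)
    ultimately show "?R S" using generate_topology_on_coarsest S by blast
  next
    fix S assume "?R S"
    then have "openin (topology ?R) S" by (simp add: istopology_subbase topology_inverse')
    then show "generate_topology_on rays S"
      by (metis (no_types, lifting) Union_rays minimal_topology_subbase openin_rays X_rays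
          openin_topology_generated_by_iff openin_topspace topspace_X)
  qed
  then show "topology (arbitrary union_of (finite intersection_of (\<lambda>x. x \<in> rays) relative_to \<Union>rays)) = X"
    by (simp add: X_rays)
next
  fix C assume C: "C \<subseteq> rays" "\<Union>C = topspace X"
  define L where "L = {q\<in>K. {x\<in>K. q \<sqsubset> x} \<in> C}"
  define R where "R = {q\<in>K. {x\<in>K. x \<sqsubset> q} \<in> C}"
  show "\<exists>C'. finite C' \<and> C' \<subseteq> C \<and> \<Union>C' = topspace X"
  proof (cases "K \<in> C")
    case True
    then show ?thesis by (intro exI[of _ "{K}"]) auto
  next
    case False
    have cov: "(\<exists>l\<in>L. l \<sqsubset> x) \<or> (\<exists>q\<in>R. x \<sqsubset> q)" if "x \<in> K" for x
    proof -
      obtain U where U: "U \<in> C" "x \<in> U" using C(2) \<open>x \<in> K\<close> by auto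
      then have "U \<in> rays" "U \<noteq> K" using C False by auto
      then show ?thesis using U unfolding rays_def L_def R_def by auto
    qed
    have "R \<noteq> {}"
    proof
      assume "R = {}"
      then obtain l where "l \<in> K" "l \<sqsubset> 0" using cov[of 0] by (auto simp: L_def K_def)
      then show False using loc_K[of l] twin_cases[of l] by (auto simp: prec_def loc_def)
    qed
    then obtain s where s: "s \<in> K" "\<And>q. q \<in> R \<Longrightarrow> q \<sqsubseteq> s"
      "\<And>y. y \<in> K \<Longrightarrow> y \<sqsubset> s \<Longrightarrow> \<exists>q\<in>R. y \<sqsubset> q"
      using supremum[of R] by (auto simp: R_def)
    then obtain l where l: "l \<in> L" "l \<sqsubset> s" using cov[of s] by (metis not_preceq_iff)
    then obtain q where q: "q \<in> R" "l \<sqsubset> q" using s(3)[of l] by (auto simp: L_def)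
    have "x \<sqsubset> q \<or> l \<sqsubset> x" for x using q(2) by (metis not_prec_iff prec_trans(3))
    then have "{x\<in>K. x \<sqsubset> q} \<union> {x\<in>K. l \<sqsubset> x} = K" by blast
    then show ?thesis using l q
      by (intro exI[of _ "{{x\<in>K. x \<sqsubset> q}, {x\<in>K. l \<sqsubset> x}}"]) (auto simp: L_def R_def)
  qed
qed

text \<open>Half-open intervals between splittings form a base of clopen sets. The endpoints \<open>-1\<close> and \<open>4\<close> lie
  strictly below and above all points of \<open>K\<close> and stand for a missing bound.\<close>

definition cell :: "real \<Rightarrow> real \<Rightarrow> real set" where
  "cell p q = {x\<in>K. p \<sqsubset> x \<and> x \<sqsubseteq> q}"

lemma prec_K_bounds:
  assumes "x \<in> K" shows "-1 \<sqsubset> x" "x \<sqsubset> 4"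
  using loc_K[OF assms] by (auto simp: prec_def loc_def)

lemma openin_up: "p \<in> insert (-1) K \<Longrightarrow> openin X {x\<in>K. p \<sqsubset> x}"
proof -
  assume p: "p \<in> insert (-1) K"
  have "{x\<in>K. -1 \<sqsubset> x} = K" using prec_K_bounds by auto
  then show ?thesis using p by (intro openin_rays) (auto simp: rays_def)
qed

lemma preceq_A_iff: "a \<in> A \<Longrightarrow> x \<in> K \<Longrightarrow> x \<sqsubseteq> a \<longleftrightarrow> x \<sqsubset> a + 2"
  using twin_cases[of x] A_bounds[of a] by (auto simp: prec_def preceq_def)

text \<open>A closed down-set ending at a lower twin is open because it is also the open down-set of the upper
  twin.\<close>

lemma openin_down: "q \<in> insert 4 A \<Longrightarrow> openin X {x\<in>K. x \<sqsubseteq> q}"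
proof -
  assume q: "q \<in> insert 4 A"
  have "{x\<in>K. x \<sqsubseteq> 4} = K" using prec_K_bounds by (auto simp: preceq_iff)
  moreover have "{x\<in>K. x \<sqsubseteq> a} \<in> rays" if "a \<in> A" for a
  proof -
    have "{x\<in>K. x \<sqsubseteq> a} = {x\<in>K. x \<sqsubset> a + 2}" using preceq_A_iff[OF that] by auto
    then show ?thesis using A_in_K(2)[OF that] by (auto simp: rays_def)
  qed
  ultimately show ?thesis using q by (intro openin_rays) (auto simp: rays_def)
qed

lemma openin_cell:
  assumes "p \<in> insert (-1) A" "q \<in> insert 4 A"
  shows "openin X (cell p q)"
proof -
  have "cell p q = {x\<in>K. p \<sqsubset> x} \<inter> {x\<in>K. x \<sqsubseteq> q}" by (auto simp: cell_def)
  then show ?thesis using openin_up[of p] openin_down[of q] assms A_in_K by auto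
qed

text \<open>Rays contain cells around each of their points by \<open>between\<close>, and cells are closed under
  intersection.\<close>

lemma cell_nbhd_ex:
  assumes "openin X U" "x \<in> U"
  shows "\<exists>p\<in>insert (-1) A. \<exists>q\<in>insert 4 A. x \<in> cell p q \<and> cell p q \<subseteq> U"
proof -
  have "generate_topology_on rays U" using assms(1) unfolding X_rays
    by (rule openin_topology_generated_by)
  then show ?thesis using assms(2)
  proof (induction arbitrary: x)
    case (Int U V)
    obtain p q p' q' where
      *: "p \<in> insert (-1) A" "q \<in> insert 4 A" "x \<in> cell p q" "cell p q \<subseteq> U"
      "p' \<in> insert (-1) A" "q' \<in> insert 4 A" "x \<in> cell p' q'" "cell p' q' \<subseteq> V"
      using Int.IH(1)[of x] Int.IH(2)[of x] Int.prems by auto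
    define m where "m = (if p \<sqsubseteq> p' then p' else p)"
    define n where "n = (if q \<sqsubseteq> q' then q else q')"
    have "x \<in> cell m n" using * by (auto simp: m_def n_def cell_def)
    moreover have "cell m n \<subseteq> cell p q \<inter> cell p' q'"
      unfolding cell_def m_def n_def by (auto simp: not_preceq_iff intro: prec_trans)
        (metis preceq_iff prec_trans not_preceq_iff)+
    moreover have "m \<in> insert (-1) A" "n \<in> insert 4 A" using * by (auto simp: m_def n_def)
    moreover have "cell p q \<inter> cell p' q' \<subseteq> U \<inter> V" using * by auto
    ultimately show ?case by (intro bexI[of _ m] bexI[of _ n]) auto
  next
    case (UN \<K>)
    then obtain k where "k \<in> \<K>" "x \<in> k" by auto
    with UN.IH[of k x] show ?case by blast
  next
    case (Basis U)
    have xK: "x \<in> K" using Basis Union_rays by auto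
    from Basis(1) consider "U = K" | q where "q \<in> K" "U = {x\<in>K. x \<sqsubset> q}"
      | q where "q \<in> K" "U = {x\<in>K. q \<sqsubset> x}" by (auto simp: rays_def)
    then show ?case
    proof cases
      case 1
      then show ?thesis using xK prec_K_bounds[OF xK]
        by (intro bexI[of _ "-1"] bexI[of _ 4]) (auto simp: cell_def preceq_iff)
    next
      case 2
      then obtain a where "a \<in> A" "x \<sqsubseteq> a" "a \<sqsubset> q" using between[of x q] Basis xK by auto
      then show ?thesis using xK prec_K_bounds[OF xK] 2
        by (intro bexI[of _ "-1"] bexI[of _ a]) (auto simp: cell_def intro: prec_trans)
    next
      case 3
      then obtain a where "a \<in> A" "q \<sqsubseteq> a" "a \<sqsubset> x" using between[of q x] Basis xK by auto
      then show ?thesis using xK prec_K_bounds[OF xK] 3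
        by (intro bexI[of _ a] bexI[of _ 4]) (auto simp: cell_def preceq_iff intro: prec_trans)
    qed
  qed auto
qed

lemma cell_nbhd:
  assumes "openin X U" "x \<in> U"
  obtains p q where "p \<in> insert (-1) A" "q \<in> insert 4 A" "x \<in> cell p q" "cell p q \<subseteq> U"
  using cell_nbhd_ex[OF assms] by blast

lemma separable_X: "separable_space X"
  unfolding separable_space_def
proof (intro exI conjI)
  let ?C = "\<rat> \<inter> {0..1::real}"
  show "countable ?C" by (intro countable_Int1 countable_rat)
  show C: "?C \<subseteq> topspace X" by (auto simp: K_def)
  have "\<exists>y\<in>?C. y \<in> U" if U: "openin X U" "x \<in> U" for x U
  proof -
    obtain p q where pq: "p \<in> insert (-1) A" "q \<in> insert 4 A" "x \<in> cell p q" "cell p q \<subseteq> U"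
      by (rule cell_nbhd[OF U])
    consider "p = -1" | "q = 4" | "p \<in> A" "q \<in> A" using pq by auto
    then have "\<exists>y\<in>?C. y \<in> cell p q"
    proof cases
      case 1
      have "0 \<sqsubseteq> q" using pq(2) A_bounds[of q] by (auto simp: preceq_def loc_def)
      then show ?thesis using prec_K_bounds[of 0] 1
        by (intro bexI[of _ 0]) (auto simp: cell_def K_def)
    next
      case 2
      have "p \<sqsubset> 1" using pq(1) A_bounds[of p] by (auto simp: prec_def loc_def)
      then show ?thesis using prec_K_bounds[of 1] 2
        by (intro bexI[of _ 1]) (auto simp: cell_def K_def preceq_iff)
    next
      case 3
      then have "p < q" using pq(3) by (auto simp: cell_def prec_def preceq_def)
      then obtain r where "r \<in> \<rat>" "p < r" "r < q" using Rats_dense_in_real by blast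
      then show ?thesis using 3 A_bounds[of p] A_bounds[of q]
        by (intro bexI[of _ r]) (auto simp: cell_def K_def prec_def preceq_def loc_def)
    qed
    then show ?thesis using pq by blast
  qed
  then show "X closure_of ?C = topspace X"
    unfolding closure_of_def by blast
qed

text \<open>For the lower bound, a base contains a set with maximum \<open>a\<close> for each \<open>a \<in> A\<close>, and distinct
  maxima give distinct sets. For the upper bound, a cell is given by two real numbers.\<close>

lemma weight_X:
  assumes "|UNIV :: real set| \<le>o |A|"
  shows "has_weight X |UNIV :: real set|"
  unfolding has_weight_def
proof (intro conjI allI impI exI)
  have lower: "|UNIV :: real set| \<le>o |\<B>|" if "base_of X \<B>" for \<B>
  proof -
    have "\<exists>U\<in>\<B>. a \<in> U \<and> U \<subseteq> {x\<in>K. x \<sqsubseteq> a}" if "a \<in> A" for a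
    proof -
      have "openin X {x\<in>K. x \<sqsubseteq> a}" using openin_down that by auto
      then have "(arbitrary union_of (\<lambda>U. U \<in> \<B>)) {x\<in>K. x \<sqsubseteq> a}"
        using \<open>base_of X \<B>\<close> by (simp add: base_of_def)
      then show ?thesis using A_in_K(1)[OF that] unfolding arbitrary_union_of_alt
        by (auto simp: Ball_def)
    qed
    then obtain U where U: "\<And>a. a \<in> A \<Longrightarrow> U a \<in> \<B> \<and> a \<in> U a \<and> U a \<subseteq> {x\<in>K. x \<sqsubseteq> a}"
      by metis
    have "inj_on U A"
    proof (rule inj_onI)
      fix a b assume ab: "a \<in> A" "b \<in> A" "U a = U b"
      then have "a \<sqsubseteq> b" "b \<sqsubseteq> a" using U[of a] U[of b] by auto
      then show "a = b" by (auto simp: preceq_def)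
    qed
    then have "|A| \<le>o |\<B>|" using U by (intro card_of_ordLeqI[of U]) auto
    then show ?thesis using assms ordLeq_transitive by blast
  qed
  then show "|UNIV :: real set| \<le>o |\<B>|" if "base_of X \<B>" for \<B> using that by blast
  define \<C> where "\<C> = (\<lambda>(p, q). cell p q) ` (insert (-1) A \<times> insert 4 A)"
  show base: "base_of X \<C>"
    unfolding base_of_def
  proof (intro ext iffI)
    fix U assume "openin X U"
    show "(arbitrary union_of (\<lambda>U. U \<in> \<C>)) U"
  unfolding arbitrary_union_of_alt
    proof (rule ballI)
      fix x assume "x \<in> U"
      then obtain p q where "p \<in> insert (-1) A" "q \<in> insert 4 A" "x \<in> cell p q" "cell p q \<subseteq> U"
        by (rule cell_nbhd[OF \<open>openin X U\<close>])
      then show "\<exists>V. V \<in> \<C> \<and> x \<in> V \<and> V \<subseteq> U"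
        unfolding \<C>_def by (intro exI[of _ "cell p q"]) auto
    qed
  next
    fix U assume "(arbitrary union_of (\<lambda>U. U \<in> \<C>)) U"
    then obtain \<U> where "\<U> \<subseteq> \<C>" "\<Union>\<U> = U" by (auto simp: union_of_def arbitrary_def)
    moreover have "openin X V" if "V \<in> \<C>" for V
      using that openin_cell by (auto simp: \<C>_def simp del: insert_iff)
    ultimately show "openin X U" by blast
  qed
  have "|\<C>| \<le>o |UNIV \<times> UNIV :: (real \<times> real) set|"
    unfolding \<C>_def by (rule ordLeq_transitive[OF card_of_image card_of_mono1]) auto
  also have "|UNIV \<times> UNIV :: (real \<times> real) set| =o |UNIV :: real set|"
    by (rule card_of_Times_same_infinite) (simp add: infinite_UNIV_char_0)
  finally show "|\<C>| =o |UNIV :: real set|"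
    using lower[OF base] by (simp add: ordIso_iff_ordLeq)
qed

section \<open>Step functions and jumps\<close>

text \<open>The linear span of the constant \<open>1\<close> and the indicators \<open>cut a\<close> for \<open>a \<in> A\<close>. It is also closed
  under multiplication with these indicators, so functions can be glued along cells.\<close>

inductive step :: "(real \<Rightarrow> real) \<Rightarrow> bool" where
  step_const: "step (\<lambda>x. c)"
| step_cut: "step g \<Longrightarrow> a \<in> A \<Longrightarrow> step (\<lambda>x. g x + c * cut a x)"

lemma step_add: "step g \<Longrightarrow> step h \<Longrightarrow> step (\<lambda>x. g x + h x)"
proof (induction rule: step.induct)
  case (step_const c)
  from step_const.prems show ?case
  proof (induction rule: step.induct)
    case (step_const d)
    show ?case by (rule step.step_const)
  next
    case (step_cut h a d)
    then show ?case using step.step_cut[of "\<lambda>x. c + h x" a d] by (simp add: add.assoc)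
  qed
next
  case (step_cut g a c)
  then show ?case using step.step_cut[of "\<lambda>x. g x + h x" a c] by (simp add: algebra_simps)
qed

lemma step_scale: "step g \<Longrightarrow> step (\<lambda>x. d * g x)"
proof (induction rule: step.induct)
  case (step_cut g a c)
  then show ?case using step.step_cut[of "\<lambda>x. d * g x" a "d * c"] by (simp add: algebra_simps)
qed (rule step.step_const)

lemma cut_mult: "cut a x * cut b x = cut (if a \<sqsubseteq> b then a else b) x"
  by (auto simp: cut_def) (metis not_preceq_iff prec_trans preceq_iff)+

lemma step_mult_cut: "step g \<Longrightarrow> a \<in> A \<Longrightarrow> step (\<lambda>x. cut a x * g x)"
proof (induction rule: step.induct)
  case (step_const c)
  then show ?case using step.step_cut[OF step.step_const[of 0], of a c] by (simp add: mult.commute)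
next
  case (step_cut g b c)
  let ?m = "if a \<sqsubseteq> b then a else b"
  have "step (\<lambda>x. cut a x * g x + c * cut ?m x)"
    using step_cut by (intro step.step_cut) auto
  then show ?case by (simp only: cut_mult[symmetric]) (simp add: algebra_simps)
qed

lemma step_cell:
  assumes "step g" "p \<in> insert (-1) A" "q \<in> insert 4 A"
  shows "\<exists>h. step h \<and> (\<forall>x\<in>K. h x = (if x \<in> cell p q then g x else 0))"
proof -
  have "\<exists>g1. step g1 \<and> (\<forall>x\<in>K. g1 x = (if x \<sqsubseteq> q then g x else 0))"
  proof (cases "q = 4")
    case True
    then show ?thesis using prec_K_bounds assms by (intro exI[of _ g]) (auto simp: preceq_iff)
  next
    case False
    then have "step (\<lambda>x. cut q x * g x)" using assms by (intro step_mult_cut) auto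
    then show ?thesis by (intro exI[of _ "\<lambda>x. cut q x * g x"]) (auto simp: cut_def simp del: not_preceq_iff)
  qed
  then obtain g1 where g1: "step g1" "\<forall>x\<in>K. g1 x = (if x \<sqsubseteq> q then g x else 0)" by blast
  have "\<exists>g2. step g2 \<and> (\<forall>x\<in>K. g2 x = (if x \<sqsubseteq> p then 0 else g1 x))"
  proof (cases "p = -1")
    case True
    then show ?thesis using prec_K_bounds g1(1)
      by (intro exI[of _ g1]) (auto simp flip: not_prec_iff)
  next
    case False
    then have "step (\<lambda>x. g1 x + (-1) * (cut p x * g1 x))"
      using g1 assms by (intro step_add step_scale step_mult_cut) auto
    then show ?thesis
      by (intro exI[of _ "\<lambda>x. g1 x + (-1) * (cut p x * g1 x)"])
        (auto simp: cut_def simp del: not_preceq_iff)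
  qed
  then obtain g2 where g2: "step g2" "\<forall>x\<in>K. g2 x = (if x \<sqsubseteq> p then 0 else g1 x)" by blast
  show ?thesis using g1 g2
    by (intro exI[of _ g2]) (auto simp: cell_def simp flip: not_preceq_iff simp del: not_preceq_iff)
qed

lemma continuous_cut:
  assumes "a \<in> A" shows "continuous_map X euclideanreal (cut a)"
proof -
  have "openin X {x\<in>K. cut a x \<in> U}" for U
  proof -
    have "{x\<in>K. cut a x \<in> U} = (if 1 \<in> U then {x\<in>K. x \<sqsubseteq> a} else {}) \<union>
        (if 0 \<in> U then {x\<in>K. a \<sqsubset> x} else {})"
      by (auto simp: cut_def simp flip: not_preceq_iff split: if_splits)
    then show ?thesis using openin_down[of a] openin_up[of a] assms A_in_K by auto
  qed
  then show ?thesis by (simp add: continuous_map_def)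
qed

lemma continuous_step: "step g \<Longrightarrow> continuous_map X euclideanreal g"
  by (induction rule: step.induct)
    (auto intro!: continuous_map_add continuous_map_real_mult continuous_cut)

text \<open>The function varies by less than \<open>e\<close> on suitable cells. Finitely many of them cover \<open>K\<close>, and a step
  function can be corrected on one cell after the other.\<close>

lemma step_dense:
  assumes f: "continuous_map X euclideanreal f" and "e > 0"
  shows "\<exists>g. step g \<and> (\<forall>x\<in>K. \<bar>f x - g x\<bar> < e)"
proof -
  define \<U> where "\<U> = {J. \<exists>p\<in>insert (-1) A. \<exists>q\<in>insert 4 A. J = cell p q \<and>
      (\<exists>c. \<forall>x\<in>J. \<bar>f x - c\<bar> < e)}"
  have "\<exists>J\<in>\<U>. x \<in> J" if "x \<in> K" for x
  proof -
    have "openin X {y \<in> topspace X. f y \<in> ball (f x) e}"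
      using f by (intro openin_continuous_map_preimage) auto
    moreover have "x \<in> {y \<in> topspace X. f y \<in> ball (f x) e}" using \<open>x \<in> K\<close> \<open>e > 0\<close> by simp
    ultimately obtain p q where "p \<in> insert (-1) A" "q \<in> insert 4 A" "x \<in> cell p q"
      "cell p q \<subseteq> {y \<in> topspace X. f y \<in> ball (f x) e}"
      by (rule cell_nbhd)
    then show ?thesis unfolding \<U>_def
      by (intro bexI[of _ "cell p q"] CollectI bexI[of _ p] bexI[of _ q] conjI exI[of _ "f x"])
        (auto simp: dist_real_def abs_minus_commute)
  qed
  then have cover: "K \<subseteq> \<Union>\<U>" by auto
  have opens: "openin X J" if "J \<in> \<U>" for J
    using that openin_cell unfolding \<U>_def by blast
  obtain \<F> where \<F>: "finite \<F>" "\<F> \<subseteq> \<U>" "K \<subseteq> \<Union>\<F>"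
    using compact_X[unfolded compact_space_alt, rule_format, of \<U>] opens cover by auto
  have "\<exists>g. step g \<and> (\<forall>x\<in>K \<inter> \<Union>\<F>. \<bar>f x - g x\<bar> < e)"
    using \<F>(1,2)
  proof (induction)
    case empty
    show ?case by (intro exI[of _ "\<lambda>x. 0"] conjI step_const) simp
  next
    case (insert J \<F>)
    then obtain g where g: "step g" "\<forall>x\<in>K \<inter> \<Union>\<F>. \<bar>f x - g x\<bar> < e" by auto
    obtain p q c where J: "p \<in> insert (-1) A" "q \<in> insert 4 A" "J = cell p q"
      "\<forall>x\<in>J. \<bar>f x - c\<bar> < e" using insert.prems unfolding \<U>_def by auto
    have "step (\<lambda>x. c + (-1) * g x)" by (intro step_add step_scale step_const g(1))
    from step_cell[OF this J(1,2)] obtain h where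
      h: "step h" "\<forall>x\<in>K. h x = (if x \<in> J then c + (-1) * g x else 0)" using J(3) by auto
    have "step (\<lambda>x. g x + h x)" by (intro step_add g(1) h(1))
    then show ?case using g(2) h(2) J(4) by (intro exI[of _ "\<lambda>x. g x + h x"]) auto
  qed
  then obtain g where "step g" "\<forall>x\<in>K \<inter> \<Union>\<F>. \<bar>f x - g x\<bar> < e" by blast
  then show ?thesis using \<F>(3) by (intro exI[of _ g]) auto
qed

text \<open>The limit from the right at a real number \<open>b\<close> is taken at the topmost point over \<open>b\<close>.\<close>

definition upper :: "real \<Rightarrow> real" where
  "upper b = (if b \<in> A then b + 2 else b)"

lemma upper_in_K: "0 < b \<Longrightarrow> b < 1 \<Longrightarrow> upper b \<in> K"
  using A_in_K by (auto simp: upper_def K_def)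

lemma step_near:
  assumes "step g" "0 < b" "b < 1"
  shows "\<exists>d>0. (\<forall>x. b - d < x \<and> x < b \<longrightarrow> g x = g b) \<and>
               (\<forall>x. b < x \<and> x < b + d \<longrightarrow> g x = g (upper b))"
  using assms
proof (induction rule: step.induct)
  case (step_const c)
  show ?case by (intro exI[of _ 1]) auto
next
  case (step_cut g a c)
  then obtain d where d: "d > 0" "\<forall>x. b - d < x \<and> x < b \<longrightarrow> g x = g b"
    "\<forall>x. b < x \<and> x < b + d \<longrightarrow> g x = g (upper b)" by auto
  define d' where "d' = min d (min (1 - b) (if a = b then 1 else \<bar>a - b\<bar>))"
  have "cut a x = cut a b" if "b - d' < x" "x < b" for x
    using that \<open>a \<in> A\<close> A_bounds[of a] \<open>b < 1\<close>
    by (auto simp: cut_def preceq_def loc_def d'_def min_less_iff_disj not_less split: if_splits)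
  moreover have "cut a x = cut a (upper b)" if "b < x" "x < b + d'" for x
    using that \<open>a \<in> A\<close> A_bounds[of a] \<open>b < 1\<close> \<open>0 < b\<close>
    by (auto simp: cut_def preceq_def loc_def d'_def upper_def split: if_splits)
  moreover have "d' > 0" "d' \<le> d" using d(1) \<open>b < 1\<close> by (auto simp: d'_def)
  ultimately show ?case using d by (intro exI[of _ d']) auto
qed

text \<open>One-sided limits in the usual topology of the reals. They exist since step functions are locally
  constant on both sides of a point and are uniformly dense.\<close>

lemma continuous_near:
  assumes "continuous_map X euclideanreal f" "0 < b" "b < 1" "e > 0"
  shows "\<exists>d>0. (\<forall>x. b - d < x \<and> x < b \<longrightarrow> \<bar>f x - f b\<bar> < e) \<and>
               (\<forall>x. b < x \<and> x < b + d \<longrightarrow> \<bar>f x - f (upper b)\<bar> < e)"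
proof -
  obtain g where g: "step g" "\<And>x. x \<in> K \<Longrightarrow> \<bar>f x - g x\<bar> < e / 2"
    using step_dense[of f "e / 2"] assms by auto
  obtain d where d: "d > 0" "\<forall>x. b - d < x \<and> x < b \<longrightarrow> g x = g b"
    "\<forall>x. b < x \<and> x < b + d \<longrightarrow> g x = g (upper b)" using step_near[OF g(1) assms(2,3)] by auto
  define d' where "d' = min d (min b (1 - b))"
  have "\<bar>f x - f b\<bar> < e" if "b - d' < x" "x < b" for x
  proof -
    have "g x = g b" "x \<in> K" "b \<in> K" using that d(2) assms by (auto simp: d'_def K_def)
    then show ?thesis using g(2)[of x] g(2)[of b] by linarith
  qed
  moreover have "\<bar>f x - f (upper b)\<bar> < e" if "b < x" "x < b + d'" for x
  proof -
    have "g x = g (upper b)" "x \<in> K" "upper b \<in> K"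
      using that d(3) assms upper_in_K by (auto simp: d'_def K_def)
    then show ?thesis using g(2)[of x] g(2)[of "upper b"] by linarith
  qed
  moreover have "d' > 0" using d(1) assms by (auto simp: d'_def)
  ultimately show ?thesis by blast
qed

definition jump :: "real \<Rightarrow> (real \<Rightarrow> real) \<Rightarrow> real" where
  "jump b f = f b - f (b + 2)"

lemma jump_cut: "a \<in> A \<Longrightarrow> b \<in> A \<Longrightarrow> jump b (cut a) = (if a = b then 1 else 0)"
  by (auto simp: jump_def cut_def preceq_def)

lemma finite_jumps_step: "step g \<Longrightarrow> finite {b\<in>A. jump b g \<noteq> 0}"
proof (induction rule: step.induct)
  case (step_cut g a c)
  have "{b\<in>A. jump b (\<lambda>x. g x + c * cut a x) \<noteq> 0} \<subseteq> insert a {b\<in>A. jump b g \<noteq> 0}"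
  proof safe
    fix b assume b: "b \<in> A" "b \<noteq> a" "jump b (\<lambda>x. g x + c * cut a x) \<noteq> 0" "jump b g = 0"
    have "jump b (\<lambda>x. g x + c * cut a x) = jump b g + c * jump b (cut a)"
      by (simp add: jump_def algebra_simps)
    then show False using b jump_cut[OF step_cut.hyps(2) b(1)] by auto
  qed
  then show ?case using step_cut.IH by (meson finite_insert finite_subset)
qed (simp add: jump_def)

text \<open>A jump of \<open>f\<close> is a jump of every step function that is close enough to \<open>f\<close>, and a step function has
  only finitely many jumps.\<close>

lemma countable_jumps:
  assumes f: "continuous_map X euclideanreal f"
  shows "countable {b\<in>A. jump b f \<noteq> 0}"
proof -
  have "\<exists>g. step g \<and> (\<forall>x\<in>K. \<bar>f x - g x\<bar> < inverse (Suc n))" for n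
    by (rule step_dense[OF f]) simp
  then obtain g where g: "\<And>n. step (g n)" "\<And>n x. x \<in> K \<Longrightarrow> \<bar>f x - g n x\<bar> < inverse (Suc n)"
    by metis
  have "{b\<in>A. jump b f \<noteq> 0} \<subseteq> (\<Union>n. {b\<in>A. jump b (g n) \<noteq> 0})"
  proof safe
    fix b assume b: "b \<in> A" "jump b f \<noteq> 0"
    then obtain n where n: "inverse (Suc n) < \<bar>jump b f\<bar> / 2"
      using reals_Archimedean[of "\<bar>jump b f\<bar> / 2"] by auto
    have "jump b (g n) \<noteq> 0"
      using n g(2)[of b n] g(2)[of "b + 2" n] A_in_K[OF b(1)] unfolding jump_def by auto
    then show "b \<in> (\<Union>n. {b\<in>A. jump b (g n) \<noteq> 0})" using b by auto
  qed
  moreover have "countable (\<Union>n. {b\<in>A. jump b (g n) \<noteq> 0})"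
    using finite_jumps_step[OF g(1)] by (intro countable_UN) (auto intro: countable_finite)
  ultimately show ?thesis by (rule countable_subset)
qed

section \<open>Bounded functionals on continuous functions\<close>

text \<open>The carrier of the Banach space of continuous functions on \<open>K\<close>: functions are \<^term>\<open>undefined\<close> off
  \<open>K\<close>, so sums and multiples need a restriction.\<close>

definition CK :: "(real \<Rightarrow> real) set" where
  "CK = {f \<in> extensional K. continuous_map X euclideanreal f}"

definition bounded_functional :: "((real \<Rightarrow> real) \<Rightarrow> real) \<Rightarrow> real \<Rightarrow> bool" where
  "bounded_functional \<phi> M \<longleftrightarrow>
     (\<forall>f\<in>CK. \<forall>g\<in>CK. \<phi> (\<lambda>x\<in>K. f x + g x) = \<phi> f + \<phi> g) \<and>
     (\<forall>c. \<forall>f\<in>CK. \<phi> (\<lambda>x\<in>K. c * f x) = c * \<phi> f) \<and>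
     (\<forall>f\<in>CK. \<forall>B. (\<forall>x\<in>K. \<bar>f x\<bar> \<le> B) \<longrightarrow> \<bar>\<phi> f\<bar> \<le> M * B)"

lemma restrict_CK: "continuous_map X euclideanreal f \<Longrightarrow> restrict f K \<in> CK"
  by (auto simp: CK_def intro: continuous_map_eq)

lemma CK_continuous: "f \<in> CK \<Longrightarrow> continuous_map X euclideanreal f"
  by (simp add: CK_def)

lemma restrict_CK_id [simp]: "f \<in> CK \<Longrightarrow> restrict f K = f"
  by (simp add: CK_def extensional_restrict)

lemma functional_add:
  assumes "bounded_functional \<phi> M"
    and "continuous_map X euclideanreal f" "continuous_map X euclideanreal g"
  shows "\<phi> (\<lambda>x\<in>K. f x + g x) = \<phi> (restrict f K) + \<phi> (restrict g K)"
proof -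
  have "(\<lambda>x\<in>K. f x + g x) = (\<lambda>x\<in>K. restrict f K x + restrict g K x)" by auto
  then show ?thesis
    using assms restrict_CK[of f] restrict_CK[of g] unfolding bounded_functional_def by metis
qed

lemma functional_scale:
  assumes "bounded_functional \<phi> M" "continuous_map X euclideanreal f"
  shows "\<phi> (\<lambda>x\<in>K. c * f x) = c * \<phi> (restrict f K)"
proof -
  have "(\<lambda>x\<in>K. c * f x) = (\<lambda>x\<in>K. c * restrict f K x)" by auto
  then show ?thesis
    using assms restrict_CK[of f] unfolding bounded_functional_def by metis
qed

lemma functional_diff:
  assumes "bounded_functional \<phi> M"
    and "continuous_map X euclideanreal f" "continuous_map X euclideanreal g"
  shows "\<phi> (\<lambda>x\<in>K. f x - g x) = \<phi> (restrict f K) - \<phi> (restrict g K)"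
  using functional_add[OF assms(1,2), of "\<lambda>x. -1 * g x"] functional_scale[OF assms(1,3), of "-1"]
    assms(3) by (simp add: continuous_map_minus)

lemma functional_bound:
  assumes "bounded_functional \<phi> M" "continuous_map X euclideanreal f"
    and "\<And>x. x \<in> K \<Longrightarrow> \<bar>f x\<bar> \<le> B"
  shows "\<bar>\<phi> (restrict f K)\<bar> \<le> M * B"
  using assms restrict_CK[of f] by (auto simp: bounded_functional_def)

abbreviation cutK :: "real \<Rightarrow> real \<Rightarrow> real" where
  "cutK a \<equiv> restrict (cut a) K"

lemma cutK_CK: "a \<in> A \<Longrightarrow> cutK a \<in> CK"
  by (intro restrict_CK continuous_cut)

text \<open>Both sides agree on the constant \<open>1\<close> and on all indicators \<open>cut a\<close>, hence on step functions, and these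
  are dense. This turns information on the indicators into information on all continuous functions.\<close>

lemma functional_eq_jump:
  assumes \<nu>: "bounded_functional \<nu> M" and b: "b \<in> A"
    and one: "\<nu> (\<lambda>x\<in>K. 1) = 0" and cut: "\<And>a. a \<in> A \<Longrightarrow> a \<noteq> b \<Longrightarrow> \<nu> (cutK a) = 0"
    and f: "f \<in> CK"
  shows "\<nu> f = \<nu> (cutK b) * jump b f"
proof -
  define N where "N g = \<nu> (restrict g K)" for g
  have step: "N g = N (cut b) * jump b g" if "step g" for g
    using that
  proof (induction rule: step.induct)
    case (step_const c)
    have "N (\<lambda>x. c) = 0"
      using functional_scale[OF \<nu>, of "\<lambda>x. 1" c] one by (simp add: N_def)
    then show ?case by (simp add: jump_def)
  next
    case (step_cut g a c)
    have "N (\<lambda>x. g x + c * cut a x) = N g + c * N (cut a)"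
      using functional_add[OF \<nu>, of g "\<lambda>x. c * cut a x"] continuous_step[OF step_cut.hyps(1)]
        functional_scale[OF \<nu>, of "cut a" c] continuous_cut[OF step_cut.hyps(2)]
      by (simp add: N_def continuous_map_real_mult_left)
    moreover have "jump b (\<lambda>x. g x + c * cut a x) = jump b g + c * jump b (cut a)"
      by (simp add: jump_def algebra_simps)
    moreover have "N (cut a) = N (cut b) * jump b (cut a)"
      using cut step_cut.hyps(2) b by (auto simp: jump_cut N_def)
    ultimately show ?case using step_cut.IH by (simp add: algebra_simps)
  qed
  define D where "D = M + 2 * \<bar>\<nu> (cutK b)\<bar>"
  have bound: "\<bar>\<nu> f - \<nu> (cutK b) * jump b f\<bar> \<le> D * e" if e: "e > 0" for e
  proof -
    obtain g where g: "step g" "\<And>x. x \<in> K \<Longrightarrow> \<bar>f x - g x\<bar> < e"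
      using step_dense[OF CK_continuous[OF f] e] by blast
    note cont = CK_continuous[OF f] continuous_step[OF g(1)]
    have "\<bar>\<nu> (\<lambda>x\<in>K. f x - g x)\<bar> \<le> M * e"
      using cont g(2) by (intro functional_bound[OF \<nu>] continuous_map_diff) (auto intro: less_imp_le)
    then have 1: "\<bar>\<nu> f - \<nu> (restrict g K)\<bar> \<le> M * e"
      using functional_diff[OF \<nu> cont] f by simp
    have "\<bar>jump b g - jump b f\<bar> \<le> 2 * e"
      using g(2)[of b] g(2)[of "b + 2"] A_in_K[OF b] by (auto simp: jump_def)
    then have "\<bar>\<nu> (cutK b) * (jump b g - jump b f)\<bar> \<le> \<bar>\<nu> (cutK b)\<bar> * (2 * e)"
      by (simp add: abs_mult mult_left_mono)
    then show ?thesis using 1 step[OF g(1)] by (simp add: N_def D_def algebra_simps)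
  qed
  have "\<bar>\<nu> f - \<nu> (cutK b) * jump b f\<bar> \<le> 0"
  proof (rule field_le_epsilon)
    fix e :: real assume "e > 0"
    then have "\<bar>\<nu> f - \<nu> (cutK b) * jump b f\<bar> \<le> D * (e / (\<bar>D\<bar> + 1))" by (intro bound) auto
    also have "\<dots> = e * (D / (\<bar>D\<bar> + 1))" by simp
    also have "\<dots> \<le> e * 1" using \<open>e > 0\<close> by (intro mult_left_mono) auto
    finally show "\<bar>\<nu> f - \<nu> (cutK b) * jump b f\<bar> \<le> 0 + e" by simp
  qed
  then show ?thesis by simp
qed

end

section \<open>Functions determined by countably many values\<close>

text \<open>The function with value \<open>v n\<close> at \<open>s n\<close>, extended to limit points of the sequence \<open>s\<close> by continuity.\<close>

definition decode :: "(nat \<Rightarrow> real) \<times> (nat \<Rightarrow> real) \<Rightarrow> real \<Rightarrow> real" where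
  "decode \<kappa> x = (let (s, v) = \<kappa> in
     if x \<in> range s then v (SOME n. s n = x) else Lim (filtercomap s (nhds x)) v)"

text \<open>A monotone function \<open>V\<close> has countably many discontinuities, and \<open>g\<close> is continuous along \<open>A\<close> wherever
  \<open>V\<close> is. So \<open>g\<close> is determined on \<open>A\<close> by its values at the discontinuities of \<open>V\<close> and on a countable dense
  subset of \<open>A\<close>.\<close>

lemma decode_dominated:
  fixes V g :: "real \<Rightarrow> real"
  assumes "mono V" and dom: "\<And>a b. a \<in> A \<Longrightarrow> b \<in> A \<Longrightarrow> a < b \<Longrightarrow> \<bar>g b - g a\<bar> \<le> V b - V a"
  shows "\<exists>\<kappa>. \<forall>a\<in>A. g a = decode \<kappa> a"
proof (cases "A = {}")
  case False
  obtain D where D: "countable D" "D \<subseteq> A" "A \<subseteq> closure D" using separable[of A] .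
  define S where "S = D \<union> {a\<in>A. \<not> isCont V a}"
  have "countable {a. \<not> isCont V a}" by (rule mono_ctble_discont[OF \<open>mono V\<close>])
  then have S: "countable S" "S \<subseteq> A" "A \<subseteq> closure S"
    using D closure_mono[of D S] by (auto simp: S_def elim: countable_subset[rotated])
  then have "S \<noteq> {}" using False by auto
  define s where "s = from_nat_into S"
  have s: "range s = S" unfolding s_def using S \<open>S \<noteq> {}\<close> by (simp add: range_from_nat_into)
  have dom': "\<bar>g a - g b\<bar> \<le> \<bar>V a - V b\<bar>" if "a \<in> A" "b \<in> A" for a b
    using dom[of a b] dom[of b a] that by (cases a b rule: linorder_cases) auto
  have "g a = decode (s, g \<circ> s) a" if a: "a \<in> A" for a
  proof (cases "a \<in> S")
    case True
    then have "\<exists>n. s n = a" using s by auto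
    then have "s (SOME n. s n = a) = a" by (rule someI_ex)
    then show ?thesis using True s by (simp add: decode_def)
  next
    case False
    define F where "F = filtercomap s (nhds a)"
    have "isCont V a" using False a by (simp add: S_def)
    have "filterlim s (nhds a) F" unfolding F_def by (rule filterlim_filtercomap)
    then have "((\<lambda>n. V (s n)) \<longlongrightarrow> V a) F"
      using \<open>isCont V a\<close> isCont_tendsto_compose by blast
    then have "((\<lambda>n. \<bar>V (s n) - V a\<bar>) \<longlongrightarrow> 0) F"
      by (intro tendsto_rabs_zero) (simp add: LIM_zero)
    then have "((\<lambda>n. g (s n) - g a) \<longlongrightarrow> 0) F"
    proof (rule Lim_null_comparison[rotated])
      have "\<bar>g (s n) - g a\<bar> \<le> \<bar>V (s n) - V a\<bar>" for n using dom'[of "s n" a] a S s by blast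
      then show "\<forall>\<^sub>F n in F. norm (g (s n) - g a) \<le> \<bar>V (s n) - V a\<bar>" by simp
    qed
    then have lim: "((g \<circ> s) \<longlongrightarrow> g a) F" by (simp add: LIM_zero_iff o_def)
    have "F \<noteq> bot"
    proof
      assume "F = bot"
      then have "eventually (\<lambda>n. False) F" by simp
      then obtain U where U: "open U" "a \<in> U" "\<And>n. s n \<notin> U"
        unfolding F_def eventually_filtercomap eventually_nhds by auto
      then have "S \<inter> U = {}" using s by auto
      then show False using U S(3) a open_Int_closure_eq_empty[OF U(1), of S] by auto
    qed
    then have "Lim F (g \<circ> s) = g a" using lim by (intro tendsto_Lim) auto
    then show ?thesis using False s by (simp add: decode_def F_def)
  qed
  then show ?thesis by blast
qed auto

section \<open>Diagonalisation over continuum many sets of pairs\<close>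

text \<open>A set of pairs is big if it cannot be exhausted by deciding the fate of fewer than continuum many
  points.\<close>

definition big :: "(real \<times> real) set \<Rightarrow> bool" where
  "big P \<longleftrightarrow> (\<forall>S :: real set. |S| <o |UNIV :: real set| \<longrightarrow>
      (\<exists>a b. (a, b) \<in> P \<and> a \<noteq> b \<and> a \<notin> S \<and> b \<notin> S))"

lemma nat_less_real: "|UNIV :: nat set| <o |UNIV :: real set|"
proof -
  have "\<not> |UNIV :: real set| \<le>o |UNIV :: nat set|"
    using uncountable_UNIV_real unfolding countable_def card_of_ordLeq[symmetric] by auto
  then show ?thesis using not_ordLeq_iff_ordLess[OF card_of_Well_order card_of_Well_order] by blast
qed

lemma infinite_real: "\<not> finite (UNIV :: real set)"
  by (simp add: infinite_UNIV_char_0)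

lemma small_Un:
  "|S| <o |UNIV :: real set| \<Longrightarrow> |T| <o |UNIV :: real set| \<Longrightarrow> |S \<union> T| <o |UNIV :: real set|"
  using card_of_Un_ordLess_infinite[OF infinite_real] .

lemma small_countable: "countable N \<Longrightarrow> |N| <o |UNIV :: real set|"
proof -
  assume "countable N"
  then have "|N| \<le>o |UNIV :: nat set|" unfolding countable_def card_of_ordLeq[symmetric] by auto
  then show ?thesis using nat_less_real ordLeq_ordLess_trans by blast
qed

lemma small_UN_countable:
  assumes S: "|S| <o |UNIV :: real set|" and N: "\<And>s. s \<in> S \<Longrightarrow> countable (N s)"
  shows "|\<Union>s\<in>S. N s| <o |UNIV :: real set|"
proof -
  let ?B = "S <+> (UNIV :: nat set)"
  have "|N s| \<le>o |?B|" if "s \<in> S" for s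
  proof -
    have "|N s| \<le>o |UNIV :: nat set|"
      using N[OF that] unfolding countable_def card_of_ordLeq[symmetric] by auto
    then show ?thesis using card_of_Plus2 ordLeq_transitive by blast
  qed
  moreover have "\<not> finite ?B" by (simp add: finite_Plus_iff)
  ultimately have "|\<Union>s\<in>S. N s| \<le>o |?B|"
    by (intro card_of_UNION_ordLeq_infinite card_of_Plus1) auto
  moreover have "|?B| <o |UNIV :: real set|"
    by (rule card_of_Plus_ordLess_infinite[OF infinite_real S nat_less_real])
  ultimately show ?thesis using ordLeq_ordLess_trans by blast
qed

text \<open>Enumerate the family along a well-order all of whose proper initial segments have fewer than
  continuum many members. At each stage the points chosen so far are too few to meet all pairs of a
  big set, so a pair of new points can be chosen there.\<close>

lemma diagonal:
  fixes \<P> :: "(real \<times> real) set set"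
  assumes card: "|\<P>| \<le>o |UNIV :: real set|" and big: "\<And>P. P \<in> \<P> \<Longrightarrow> big P"
  shows "\<exists>f g. (\<forall>P\<in>\<P>. (f P, g P) \<in> P) \<and> inj_on f \<P> \<and> f ` \<P> \<inter> g ` \<P> = {}"
proof -
  let ?r = "|\<P>|"
  have wo: "well_order_on \<P> ?r" by (rule card_of_well_order_on)
  define S where "S = (\<lambda>(h :: (real \<times> real) set \<Rightarrow> real \<times> real) P.
      fst ` h ` underS ?r P \<union> snd ` h ` underS ?r P)"
  define Q where "Q = (\<lambda>h P p. P \<in> \<P> \<longrightarrow>
      p \<in> P \<and> fst p \<noteq> snd p \<and> fst p \<notin> S h P \<and> snd p \<notin> S h P)"
  have "\<exists>h. \<forall>P. Q h P (h P)"
  proof (rule dependent_wf_choice)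
    show "wf (?r - Id)" using wo by (simp add: well_order_on_def)
  next
    fix h h' :: "(real \<times> real) set \<Rightarrow> real \<times> real" and P p
    assume "\<And>z. (z, P) \<in> ?r - Id \<Longrightarrow> h z = h' z"
    then have "h ` underS ?r P = h' ` underS ?r P" by (auto simp: underS_def image_def)
    then show "Q h P p = Q h' P p" by (simp add: Q_def S_def)
  next
    fix P and h :: "(real \<times> real) set \<Rightarrow> real \<times> real"
    show "\<exists>p. Q h P p"
    proof (cases "P \<in> \<P>")
      case True
      have "|underS ?r P| <o ?r" 
        using True by (intro card_of_underS card_of_Card_order) (simp add: Field_card_of)
      then have "|underS ?r P| <o |UNIV :: real set|" using card ordLess_ordLeq_trans by blast
      then have "|S h P| <o |UNIV :: real set|" unfolding S_def case_prod_conv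
        by (intro small_Un; metis card_of_image ordLeq_ordLess_trans)
      then show ?thesis using big[OF True] unfolding big_def Q_def by fastforce
    qed (auto simp: Q_def)
  qed
  then obtain h where h: "\<And>P. Q h P (h P)" by blast
  have in_S: "fst (h P) \<in> S h P' \<and> snd (h P) \<in> S h P'" if "P \<in> underS ?r P'" for P P'
    using that by (auto simp: S_def)
  have lin: "P \<in> underS ?r P' \<or> P' \<in> underS ?r P" if "P \<in> \<P>" "P' \<in> \<P>" "P \<noteq> P'" for P P'
    using wo that unfolding well_order_on_def linear_order_on_def total_on_def underS_def by auto
  show ?thesis
  proof (rule exI[of _ "fst \<circ> h"], rule exI[of _ "snd \<circ> h"], intro conjI ballI)
    show "((fst \<circ> h) P, (snd \<circ> h) P) \<in> P" if "P \<in> \<P>" for P using h[of P] that by (simp add: Q_def)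
    show "inj_on (fst \<circ> h) \<P>"
    proof (rule inj_onI, rule ccontr)
      fix P P' assume *: "P \<in> \<P>" "P' \<in> \<P>" "(fst \<circ> h) P = (fst \<circ> h) P'" "P \<noteq> P'"
      then show False using lin[OF *(1,2,4)] in_S[of P P'] in_S[of P' P] h[of P] h[of P']
        by (auto simp: Q_def)
    qed
    have "fst (h P) \<noteq> snd (h P')" if "P \<in> \<P>" "P' \<in> \<P>" for P P'
    proof (cases "P = P'")
      case True
      then show ?thesis using h[of P] that by (simp add: Q_def)
    next
      case False
      then show ?thesis using lin[OF that False] in_S[of P P'] in_S[of P' P] h[of P] h[of P'] that
        by (auto simp: Q_def)
    qed
    then show "(fst \<circ> h) ` \<P> \<inter> (snd \<circ> h) ` \<P> = {}" by auto
  qed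
qed

text \<open>A code becomes a set of natural numbers: encode each real number as such a set and collect all
  membership facts.\<close>

lemma codes_le_real:
  "|UNIV :: (rat \<Rightarrow> (nat \<Rightarrow> real) \<times> (nat \<Rightarrow> real)) set| \<le>o |UNIV :: real set|"
proof -
  obtain e :: "real \<Rightarrow> nat set" where e: "inj e"
    using nat_sets_eqpoll_reals eqpoll_sym eqpoll_imp_lepoll unfolding lepoll_def by metis
  define F where "F = (\<lambda>\<kappa> :: rat \<Rightarrow> (nat \<Rightarrow> real) \<times> (nat \<Rightarrow> real).
    (to_nat :: rat \<times> nat \<times> nat \<times> bool \<Rightarrow> nat) `
      {(q, n, m, b). m \<in> e ((if b then fst else snd) (\<kappa> q) n)})"
  have "inj F"
  proof (rule injI)
    fix \<kappa> \<kappa>' assume "F \<kappa> = F \<kappa>'"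
    then have eq: "{(q, n, m, b). m \<in> e ((if b then fst else snd) (\<kappa> q) n)}
        = {(q, n, m, b). m \<in> e ((if b then fst else snd) (\<kappa>' q) n)}"
      unfolding F_def by (subst (asm) inj_image_eq_iff) auto
    have "e ((if b then fst else snd) (\<kappa> q) n) = e ((if b then fst else snd) (\<kappa>' q) n)" for q n b
    proof (rule set_eqI)
      fix m
      show "m \<in> e ((if b then fst else snd) (\<kappa> q) n) \<longleftrightarrow> m \<in> e ((if b then fst else snd) (\<kappa>' q) n)"
        using set_mp[OF equalityD1[OF eq], of "(q, n, m, b)"]
          set_mp[OF equalityD2[OF eq], of "(q, n, m, b)"] by auto
    qed
    then have *: "(if b then fst else snd) (\<kappa> q) n = (if b then fst else snd) (\<kappa>' q) n" for q n b
      using e by (meson injD)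
    show "\<kappa> = \<kappa>'"
      using *[of True] *[of False] by (intro ext prod_eqI) auto
  qed
  then have "|UNIV :: (rat \<Rightarrow> (nat \<Rightarrow> real) \<times> (nat \<Rightarrow> real)) set| \<le>o |UNIV :: nat set set|"
    by (intro card_of_ordLeqI) auto
  also have "|UNIV :: nat set set| =o |UNIV :: real set|"
    using nat_sets_eqpoll_reals by (simp add: eqpoll_iff_card_of_ordIso)
  finally show ?thesis .
qed

lemma interval_card: "x < y \<Longrightarrow> |UNIV :: real set| \<le>o |{x<..<y :: real}|"
  using open_interval_eqpoll_reals[of x y] 
  by (simp add: eqpoll_iff_card_of_ordIso ordIso_iff_ordLeq)

lemma big_square:
  assumes "x < y" shows "big ({x<..<y} \<times> {x<..<y})"
  unfolding big_def
proof (intro allI impI)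
  fix S :: "real set" assume S: "|S| <o |UNIV :: real set|"
  have *: "\<exists>a. a \<in> {x<..<y} \<and> a \<notin> T" if "|T| <o |UNIV :: real set|" for T
  proof (rule ccontr)
    assume "\<not> ?thesis"
    then have "{x<..<y} \<subseteq> T" by auto
    then have "|UNIV :: real set| \<le>o |T|"
      using interval_card[OF assms] card_of_mono1 ordLeq_transitive by blast
    then show False using that not_ordLess_ordLeq by blast
  qed
  obtain a where a: "a \<in> {x<..<y}" "a \<notin> S" using *[OF S] by auto
  have "|{a} \<union> S| <o |UNIV :: real set|" by (intro small_Un S small_countable) auto
  from *[OF this] obtain b where "b \<in> {x<..<y}" "b \<notin> S" "b \<noteq> a" by auto
  with a show "\<exists>a b. (a, b) \<in> {x<..<y} \<times> {x<..<y} \<and> a \<noteq> b \<and> a \<notin> S \<and> b \<notin> S" by blast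
qed

text \<open>When \<open>decode (\<kappa> q) a\<close> is the value at the rational \<open>q\<close> of the image of \<open>cut a\<close> under an operator, this
  consists of the pairs \<open>(a, b)\<close> for which that image has no limit at \<open>b\<close>. The definition does not mention
  \<open>A\<close>, so all codes can be treated before \<open>A\<close> is known.\<close>

definition discontinuities :: "(rat \<Rightarrow> (nat \<Rightarrow> real) \<times> (nat \<Rightarrow> real)) \<Rightarrow> (real \<times> real) set" where
  "discontinuities \<kappa> = {(a, b). a \<in> {0<..<1} \<and> b \<in> {0<..<1} \<and>
     \<not> (\<exists>l. \<forall>e>0. \<exists>d>0. \<forall>q. \<bar>of_rat q - b\<bar> < d \<longrightarrow> \<bar>decode (\<kappa> q) a - l\<bar> < e)}"

section \<open>Operators move few jumps\<close>

context split_interval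
begin

text \<open>The dominating monotone function \<open>V\<close> is the total variation of the functional on initial segments,
  that is, the supremum of the values at functions bounded by \<open>1\<close> and supported there. If \<open>h\<close> lives up to
  \<open>a\<close>, then \<open>h\<close> plus or minus the indicator of the points in \<open>(a, b]\<close> lives up to \<open>b\<close> and is still bounded
  by \<open>1\<close>, so \<open>V\<close> increases from \<open>a\<close> to \<open>b\<close> by at least the change of the functional.\<close>

lemma functional_cut_coded:
  assumes \<phi>: "bounded_functional \<phi> M"
  shows "\<exists>\<kappa>. \<forall>a\<in>A. \<phi> (cutK a) = decode \<kappa> a"
proof -
  \<comment> \<open>The support condition puts the lower twin over \<open>x\<close> in the segment up to \<open>x\<close> but not the upper one.\<close>
  define W where "W x = {h. continuous_map X euclideanreal h \<and>
      (\<forall>y\<in>K. \<bar>h y\<bar> \<le> 1 \<and> (h y \<noteq> 0 \<longrightarrow> loc y < x \<or> y = x))}" for x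
  define V where "V x = Sup ((\<lambda>h. \<phi> (restrict h K)) ` W x)" for x
  have zero: "(\<lambda>y. 0) \<in> W x" for x by (simp add: W_def)
  have bdd: "bdd_above ((\<lambda>h. \<phi> (restrict h K)) ` W x)" for x
  proof (rule bdd_aboveI2)
    fix h assume "h \<in> W x"
    then have "\<bar>\<phi> (restrict h K)\<bar> \<le> M * 1" by (intro functional_bound[OF \<phi>]) (auto simp: W_def)
    then show "\<phi> (restrict h K) \<le> M" by simp
  qed
  have "W x \<subseteq> W y" if "x \<le> y" for x y
  proof -
    have "loc x \<le> x" by (simp add: loc_def)
    have "loc z < y \<or> z = y" if "loc z < x \<or> z = x" for z
      using that \<open>loc x \<le> x\<close> \<open>x \<le> y\<close> by auto
    then show ?thesis unfolding W_def by blast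
  qed
  moreover have "W x \<noteq> {}" for x using zero by blast
  ultimately have "mono V" unfolding V_def using bdd
    by (intro monoI cSup_subset_mono image_mono) auto
  moreover have "\<bar>\<phi> (cutK b) - \<phi> (cutK a)\<bar> \<le> V b - V a" if a: "a \<in> A" and b: "b \<in> A" and "a < b" for a b
  proof -
    have "\<phi> (restrict h K) \<le> V b - \<bar>\<phi> (cutK b) - \<phi> (cutK a)\<bar>" if h: "h \<in> W a" for h
    proof -
      have *: "\<phi> (restrict h K) + c * (\<phi> (cutK b) - \<phi> (cutK a)) \<le> V b" if c: "\<bar>c\<bar> = 1" for c
      proof -
        let ?d = "\<lambda>y. cut b y - cut a y"
        have hc: "continuous_map X euclideanreal h" using h by (simp add: W_def)
        have dc: "continuous_map X euclideanreal (\<lambda>y. c * ?d y)"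
          by (intro continuous_map_real_mult_left continuous_map_diff continuous_cut a b)
        have d: "\<bar>?d y\<bar> \<le> 1 \<and> (?d y \<noteq> 0 \<longrightarrow> (loc y < b \<or> y = b) \<and> \<not> (loc y < a \<or> y = a))"
          if "y \<in> K" for y
          using \<open>a < b\<close> a b twin_cases[OF that] by (auto simp: cut_def preceq_def split: if_splits)
        have "(\<lambda>y. h y + c * ?d y) \<in> W b"
        proof -
          have "\<bar>h y + c * ?d y\<bar> \<le> 1 \<and> (h y + c * ?d y \<noteq> 0 \<longrightarrow> loc y < b \<or> y = b)"
            if y: "y \<in> K" for y
          proof (cases "?d y = 0")
            case True
            then show ?thesis using h y \<open>a < b\<close> a b by (auto simp: W_def)
          next
            case False
            then have "h y = 0" using d[OF y] h y by (auto simp: W_def)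
            then show ?thesis using d[OF y] c by (auto simp: abs_mult)
          qed
          then show ?thesis using hc dc by (auto simp: W_def intro: continuous_map_add)
        qed
        then have "\<phi> (\<lambda>y\<in>K. h y + c * ?d y) \<le> V b"
          unfolding V_def by (intro cSup_upper bdd image_eqI[OF refl])
        then show ?thesis
          using functional_add[OF \<phi> hc dc] functional_scale[OF \<phi>, of ?d c]
            functional_diff[OF \<phi> continuous_cut[OF b] continuous_cut[OF a]]
          by (simp add: continuous_map_diff continuous_cut a b)
      qed
      show ?thesis using *[of 1] *[of "-1"] by (simp add: abs_if)
    qed
    then have "V a \<le> V b - \<bar>\<phi> (cutK b) - \<phi> (cutK a)\<bar>"
      unfolding V_def[of a] using zero by (intro cSup_least) auto
    then show ?thesis by simp
  qed
  ultimately show ?thesis by (rule decode_dominated)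
qed

text \<open>The rationals on the two sides of \<open>b\<close> yield the two different values at the twins over \<open>b\<close>.\<close>

lemma no_limit_at_jump:
  assumes f: "continuous_map X euclideanreal f" and b: "b \<in> A" "jump b f \<noteq> 0"
  shows "\<not> (\<exists>l. \<forall>e>0. \<exists>d>0. \<forall>q. \<bar>of_rat q - b\<bar> < d \<longrightarrow> \<bar>f (of_rat q) - l\<bar> < e)"
proof
  assume "\<exists>l. \<forall>e>0. \<exists>d>0. \<forall>q. \<bar>of_rat q - b\<bar> < d \<longrightarrow> \<bar>f (of_rat q) - l\<bar> < e"
  then obtain l where l: "\<And>e. e > 0 \<Longrightarrow> \<exists>d>0. \<forall>q. \<bar>of_rat q - b\<bar> < d \<longrightarrow> \<bar>f (of_rat q) - l\<bar> < e"
    by blast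
  define e where "e = \<bar>jump b f\<bar> / 4"
  have "e > 0" using b by (simp add: e_def)
  obtain d where d: "d > 0" "\<And>q. \<bar>of_rat q - b\<bar> < d \<Longrightarrow> \<bar>f (of_rat q) - l\<bar> < e"
    using l[OF \<open>e > 0\<close>] by blast
  have "0 < b" "b < 1" using A_bounds[OF b(1)] by auto
  then obtain d' where d': "d' > 0" "\<And>x. b - d' < x \<and> x < b \<Longrightarrow> \<bar>f x - f b\<bar> < e"
    "\<And>x. b < x \<and> x < b + d' \<Longrightarrow> \<bar>f x - f (upper b)\<bar> < e"
    using continuous_near[OF f _ _ \<open>e > 0\<close>, of b] by blast
  obtain q where q: "b - min d d' < of_rat q" "of_rat q < b"
    using of_rat_dense[of "b - min d d'" b] d d' by auto
  obtain r where r: "b < of_rat r" "of_rat r < b + min d d'"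
    using of_rat_dense[of b "b + min d d'"] d d' by auto
  have "\<bar>f (of_rat q) - l\<bar> < e" "\<bar>f (of_rat r) - l\<bar> < e" using q r by (auto intro!: d)
  moreover have "\<bar>f (of_rat q) - f b\<bar> < e" "\<bar>f (of_rat r) - f (b + 2)\<bar> < e"
    using q r d'(2)[of "of_rat q"] d'(3)[of "of_rat r"] b(1) by (auto simp: upper_def)
  ultimately have "\<bar>f b - f (b + 2)\<bar> < 4 * e" by linarith
  then show False by (simp add: e_def jump_def)
qed

lemma limit_off_A:
  assumes f: "continuous_map X euclideanreal f" and b: "0 < b" "b < 1" "b \<notin> A" and "e > 0"
  shows "\<exists>d>0. \<forall>x. \<bar>x - b\<bar> < d \<longrightarrow> \<bar>f x - f b\<bar> < e"
proof -
  obtain d where d: "d > 0" "\<And>x. b - d < x \<and> x < b \<Longrightarrow> \<bar>f x - f b\<bar> < e"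
    "\<And>x. b < x \<and> x < b + d \<Longrightarrow> \<bar>f x - f (upper b)\<bar> < e"
    using continuous_near[OF f b(1,2) \<open>e > 0\<close>] by blast
  have "\<bar>f x - f b\<bar> < e" if "\<bar>x - b\<bar> < d" for x
    using d(2)[of x] d(3)[of x] that \<open>e > 0\<close> b(3)
    by (cases x b rule: linorder_cases) (auto simp: upper_def)
  then show ?thesis using d(1) by blast
qed

text \<open>Encode the images of all \<open>cut a\<close> at rational points by some \<open>\<kappa>\<close>. A set \<open>S\<close> of fewer than continuum
  many points accounts for few \<open>b\<close>: those in \<open>S\<close> and, for each \<open>s \<in> S\<close>, the countably many jumps of
  the image of \<open>cut s\<close>. If there were continuum many bad \<open>b\<close>, then \<open>discontinuities \<kappa>\<close> would
  therefore be big, and the hypothesis on \<open>A\<close> would give an image without limit at a point that is not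
  split.\<close>

lemma few_moved_jumps:
  assumes caught: "\<And>\<kappa>. big (discontinuities \<kappa>) \<Longrightarrow> \<exists>a b. (a, b) \<in> discontinuities \<kappa> \<and> a \<in> A \<and> b \<notin> A"
    and T: "\<And>f. f \<in> CK \<Longrightarrow> T f \<in> CK" "\<And>x. x \<in> K \<Longrightarrow> bounded_functional (\<lambda>f. T f x) M"
  shows "|{b\<in>A. \<exists>a\<in>A. a \<noteq> b \<and> jump b (T (cutK a)) \<noteq> 0}| <o |UNIV :: real set|" (is "|?E| <o _")
proof (rule ccontr)
  assume "\<not> ?thesis"
  then have E: "|UNIV :: real set| \<le>o |?E|"
    using not_ordLess_iff_ordLeq[OF card_of_Well_order card_of_Well_order] by blast
  have cont: "continuous_map X euclideanreal (T (cutK a))" if "a \<in> A" for a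
    using T(1) cutK_CK that CK_continuous by blast
  have "\<exists>\<kappa>. of_rat q \<in> K \<longrightarrow> (\<forall>a\<in>A. T (cutK a) (of_rat q) = decode \<kappa> a)" for q
    using functional_cut_coded[OF T(2)] by blast
  then obtain \<kappa> where \<kappa>: "\<And>q a. of_rat q \<in> K \<Longrightarrow> a \<in> A \<Longrightarrow> T (cutK a) (of_rat q) = decode (\<kappa> q) a"
    by metis
  have near: "\<exists>d'>0. d' \<le> d \<and> (\<forall>x. \<bar>x - b\<bar> < d' \<longrightarrow> x \<in> K)"
    if "0 < b" "b < 1" "d > 0" for b d :: real
    using that by (intro exI[of _ "min d (min b (1 - b))"]) (auto simp: K_def)
  have limit: "(\<exists>l. \<forall>e>0. \<exists>d>0. \<forall>q. \<bar>of_rat q - b\<bar> < d \<longrightarrow> \<bar>T (cutK a) (of_rat q) - l\<bar> < e)"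
    if ab: "(a, b) \<notin> discontinuities \<kappa>" "a \<in> A" "0 < b" "b < 1" for a b
  proof -
    obtain l where l: "\<And>e. e > 0 \<Longrightarrow> \<exists>d>0. \<forall>q. \<bar>of_rat q - b\<bar> < d \<longrightarrow> \<bar>decode (\<kappa> q) a - l\<bar> < e"
      using ab A_bounds[of a] unfolding discontinuities_def by force
    have "\<exists>d>0. \<forall>q. \<bar>of_rat q - b\<bar> < d \<longrightarrow> \<bar>T (cutK a) (of_rat q) - l\<bar> < e" if e: "e > 0" for e
    proof -
      obtain d where d: "d > 0" "\<And>q. \<bar>of_rat q - b\<bar> < d \<Longrightarrow> \<bar>decode (\<kappa> q) a - l\<bar> < e"
        using l[OF e] by blast
      obtain d' where "d' > 0" "d' \<le> d" "\<And>x. \<bar>x - b\<bar> < d' \<Longrightarrow> x \<in> K"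
        using near[OF \<open>0 < b\<close> \<open>b < 1\<close> d(1)] by blast
      then show ?thesis using d(2) \<kappa> \<open>a \<in> A\<close> by (intro exI[of _ d']) (auto intro: less_le_trans)
    qed
    then show ?thesis by blast
  qed
  have "big (discontinuities \<kappa>)"
    unfolding big_def
  proof (intro allI impI)
    fix S :: "real set" assume S: "|S| <o |UNIV :: real set|"
    define N where "N = (\<Union>s\<in>S. {b\<in>A. s \<in> A \<and> jump b (T (cutK s)) \<noteq> 0})"
    have "|N| <o |UNIV :: real set|" unfolding N_def
    proof (rule small_UN_countable[OF S])
      show "countable {b \<in> A. s \<in> A \<and> jump b (T (cutK s)) \<noteq> 0}" for s
        using countable_jumps[OF cont, of s] by (cases "s \<in> A") auto
    qed
    then have "|S \<union> N| <o |UNIV :: real set|" by (rule small_Un[OF S])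
    then have "\<not> ?E \<subseteq> S \<union> N"
      using E card_of_mono1 ordLeq_transitive not_ordLess_ordLeq by blast
    then obtain a b where ab: "a \<in> A" "b \<in> A" "a \<noteq> b" "jump b (T (cutK a)) \<noteq> 0" "b \<notin> S" "b \<notin> N"
      by auto
    then have "a \<notin> S" by (auto simp: N_def)
    moreover have "(a, b) \<in> discontinuities \<kappa>"
      using limit[of a b] no_limit_at_jump[OF cont[OF ab(1)] ab(2,4)] ab A_bounds[of b] by blast
    ultimately show "\<exists>a b. (a, b) \<in> discontinuities \<kappa> \<and> a \<noteq> b \<and> a \<notin> S \<and> b \<notin> S" using ab by blast
  qed
  then obtain a b where ab: "(a, b) \<in> discontinuities \<kappa>" "a \<in> A" "b \<notin> A" using caught by blast
  then have b: "0 < b" "b < 1" by (auto simp: discontinuities_def)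
  have "\<exists>d>0. \<forall>q. \<bar>of_rat q - b\<bar> < d \<longrightarrow> \<bar>decode (\<kappa> q) a - T (cutK a) b\<bar> < e" if e: "e > 0" for e
  proof -
    obtain d where d: "d > 0" "\<And>x. \<bar>x - b\<bar> < d \<Longrightarrow> \<bar>T (cutK a) x - T (cutK a) b\<bar> < e"
      using limit_off_A[OF cont[OF ab(2)] b ab(3) e] by blast
    obtain d' where "d' > 0" "d' \<le> d" "\<And>x. \<bar>x - b\<bar> < d' \<Longrightarrow> x \<in> K"
      using near[OF b d(1)] by blast
    then show ?thesis using d(2) \<kappa>[of _ a] ab(2)
      by (intro exI[of _ d']) (metis less_le_trans)
  qed
  then show False using ab(1) unfolding discontinuities_def by blast
qed

section \<open>Isomorphisms with the square\<close>

lemma zero_in_K: "0 \<in> K"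
  by (simp add: K_def)

lemma mspace_C_space: "mspace (cfunspace X euclidean_metric) = CK"
proof -
  have "bounded (f ` K)" if "continuous_map X euclideanreal f" for f
  proof -
    have "compactin euclideanreal (f ` topspace X)"
      using that compact_X image_compactin compact_space_def by blast
    then show ?thesis by (simp add: compact_imp_bounded)
  qed
  then show ?thesis by (auto simp: CK_def)
qed

declare mspace_cfunspace [simp del] mspace_C_space [simp]

text \<open>Continuity at the zero function and homogeneity give a bound, and it is uniform in the point at
  which the images are evaluated.\<close>

lemma operator_bounded:
  assumes T: "continuous_map (mtopology_of (cfunspace X euclidean_metric))
      (mtopology_of (cfunspace X euclidean_metric)) T"
    and add: "\<And>f g. f \<in> CK \<Longrightarrow> g \<in> CK \<Longrightarrow> T (\<lambda>x\<in>K. f x + g x) = (\<lambda>x\<in>K. T f x + T g x)"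
    and scale: "\<And>c f. f \<in> CK \<Longrightarrow> T (\<lambda>x\<in>K. c * f x) = (\<lambda>x\<in>K. c * T f x)"
  shows "\<exists>M. (\<forall>f\<in>CK. T f \<in> CK) \<and> (\<forall>x\<in>K. bounded_functional (\<lambda>f. T f x) M)"
proof -
  let ?C = "cfunspace X (euclidean_metric :: real metric)"
  have TCK: "T f \<in> CK" if "f \<in> CK" for f
    using that continuous_map_image_subset_topspace[OF T] by auto
  define z :: "real \<Rightarrow> real" where "z = (\<lambda>x\<in>K. 0)"
  have z: "z \<in> CK" unfolding z_def by (rule restrict_CK) simp
  have Tz: "T z = z" using scale[OF z, of 0] by (simp add: z_def)
  have dist_z: "mdist ?C z f \<le> c \<longleftrightarrow> (\<forall>x\<in>K. \<bar>f x\<bar> \<le> c)" if "f \<in> CK" for f c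
  proof -
    have "topspace X \<noteq> {}" using zero_in_K by auto
    then show ?thesis
      using cfunspace_mdist_le[of z X euclidean_metric f c] that z
      by (simp add: z_def dist_real_def)
  qed
  have "\<forall>a\<in>CK. \<forall>e>0. \<exists>d>0. \<forall>f. f \<in> CK \<and> mdist ?C a f < d \<longrightarrow> mdist ?C (T a) (T f) < e"
    using T Metric_space.metric_continuous_map[OF Metric_space_mspace_mdist[of ?C]
        Metric_space_mspace_mdist[of ?C], of T]
    by (simp add: mtopology_of_def)
  then have "\<exists>d>0. \<forall>f. f \<in> CK \<and> mdist ?C z f < d \<longrightarrow> mdist ?C z (T f) < 1"
    using z Tz zero_less_one by metis
  then obtain d where d: "d > 0" "\<And>f. f \<in> CK \<Longrightarrow> mdist ?C z f < d \<Longrightarrow> mdist ?C z (T f) < 1"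
    by blast
  have unit: "\<bar>T f x\<bar> \<le> 1" if "f \<in> CK" "\<And>y. y \<in> K \<Longrightarrow> \<bar>f y\<bar> \<le> d / 2" "x \<in> K" for f x
  proof -
    have "mdist ?C z f \<le> d / 2" using dist_z[OF that(1)] that(2) by blast
    then have "mdist ?C z (T f) \<le> 1" using d that(1) by (intro less_imp_le d(2)) auto
    then show ?thesis using dist_z[OF TCK[OF that(1)]] that(3) by auto
  qed
  have bound: "\<bar>T f x\<bar> \<le> (2 / d) * B" if f: "f \<in> CK" and B: "\<forall>y\<in>K. \<bar>f y\<bar> \<le> B" and x: "x \<in> K" for f x B
  proof (cases "B \<le> 0")
    case True
    have "\<bar>f 0\<bar> \<le> B" using B zero_in_K by auto
    then have "B = 0" using True by linarith
    have "f = z" using f B \<open>B = 0\<close> by (auto simp: z_def CK_def extensional_def)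
    then show ?thesis using Tz x \<open>B = 0\<close> by (simp add: z_def)
  next
    case False
    let ?c = "d / (2 * B)"
    have "\<bar>T (\<lambda>y\<in>K. ?c * f y) x\<bar> \<le> 1"
    proof (rule unit[OF _ _ x])
      show "(\<lambda>y\<in>K. ?c * f y) \<in> CK"
        by (intro restrict_CK continuous_map_real_mult_left CK_continuous f)
      fix y assume y: "y \<in> K"
      have "\<bar>?c * f y\<bar> = ?c * \<bar>f y\<bar>" using False d(1) by (simp add: abs_mult)
      also have "\<dots> \<le> ?c * B" using B y False d(1) by (intro mult_left_mono) auto
      also have "\<dots> = d / 2" using False by simp
      finally show "\<bar>(\<lambda>y\<in>K. ?c * f y) y\<bar> \<le> d / 2" using y by simp
    qed
    then have "?c * \<bar>T f x\<bar> \<le> 1" using scale[OF f, of ?c] x d(1) False by (simp add: abs_mult)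
    then show ?thesis using d(1) False by (simp add: field_simps)
  qed
  have "bounded_functional (\<lambda>f. T f x) (2 / d)" if "x \<in> K" for x
    unfolding bounded_functional_def using add scale bound that by simp
  then show ?thesis using TCK by blast
qed

text \<open>At a point \<open>b\<close> that is exceptional for neither component, both components multiply the jump at \<open>b\<close> by
  a constant. The preimages of \<open>(cut b, 0)\<close> and \<open>(0, cut b)\<close> then require these constants to be nonzero
  and the jump of the first preimage to be both zero and nonzero.\<close>

lemma not_isomorphic_to_square:
  assumes caught: "\<And>\<kappa>. big (discontinuities \<kappa>) \<Longrightarrow> \<exists>a b. (a, b) \<in> discontinuities \<kappa> \<and> a \<in> A \<and> b \<notin> A"
    and A: "|UNIV :: real set| \<le>o |A|"
  shows "\<not> linearly_homeomorphic (C_space X) (prod_vs (C_space X) (C_space X))"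
proof
  let ?C = "cfunspace X (euclidean_metric :: real metric)"
  assume "linearly_homeomorphic (C_space X) (prod_vs (C_space X) (C_space X))"
  then obtain T where lin: "linear_map_vs (C_space X) (prod_vs (C_space X) (C_space X)) T"
    and hom: "homeomorphic_map (mtopology_of ?C) (mtopology_of (prod_metric ?C ?C)) T"
    by (auto simp: linearly_homeomorphic_def C_space_def prod_vs_def)
  have cont: "continuous_map (mtopology_of ?C) (prod_topology (mtopology_of ?C) (mtopology_of ?C)) T"
    using homeomorphic_imp_continuous_map[OF hom] by (simp add: mtopology_of_prod_metric)
  have surj: "T ` CK = CK \<times> CK"
    using homeomorphic_imp_surjective_map[OF hom] by (simp add: mspace_C_space)
  have add: "T (\<lambda>x\<in>K. f x + g x) = (\<lambda>x\<in>K. fst (T f) x + fst (T g) x, \<lambda>x\<in>K. snd (T f) x + snd (T g) x)"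
    if "f \<in> CK" "g \<in> CK" for f g
    using lin that by (simp add: linear_map_vs_def C_space_def prod_vs_def mspace_C_space)
  have scale: "T (\<lambda>x\<in>K. c * f x) = (\<lambda>x\<in>K. c * fst (T f) x, \<lambda>x\<in>K. c * snd (T f) x)"
    if "f \<in> CK" for c f
    using lin that by (simp add: linear_map_vs_def C_space_def prod_vs_def mspace_C_space)
  have "\<exists>M. (\<forall>f\<in>CK. fst (T f) \<in> CK) \<and> (\<forall>x\<in>K. bounded_functional (\<lambda>f. fst (T f) x) M)"
    by (rule operator_bounded) (use continuous_map_fst_of[OF cont] in \<open>simp_all add: o_def add scale\<close>)
  then obtain M1 where T1: "\<And>x. x \<in> K \<Longrightarrow> bounded_functional (\<lambda>f. fst (T f) x) M1"
    "\<And>f. f \<in> CK \<Longrightarrow> fst (T f) \<in> CK" by blast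
  have "\<exists>M. (\<forall>f\<in>CK. snd (T f) \<in> CK) \<and> (\<forall>x\<in>K. bounded_functional (\<lambda>f. snd (T f) x) M)"
    by (rule operator_bounded) (use continuous_map_snd_of[OF cont] in \<open>simp_all add: o_def add scale\<close>)
  then obtain M2 where T2: "\<And>x. x \<in> K \<Longrightarrow> bounded_functional (\<lambda>f. snd (T f) x) M2"
    "\<And>f. f \<in> CK \<Longrightarrow> snd (T f) \<in> CK" by blast
  define one :: "real \<Rightarrow> real" where "one = (\<lambda>x\<in>K. 1)"
  have one: "one \<in> CK" unfolding one_def by (rule restrict_CK) simp
  define E where "E = (\<lambda>S :: (real \<Rightarrow> real) \<Rightarrow> real \<Rightarrow> real.
      {b\<in>A. \<exists>a\<in>A. a \<noteq> b \<and> jump b (S (cutK a)) \<noteq> 0} \<union> {b\<in>A. jump b (S one) \<noteq> 0})"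
  have small: "|E S| <o |UNIV :: real set|"
    if "\<And>f. f \<in> CK \<Longrightarrow> S f \<in> CK" "\<And>x. x \<in> K \<Longrightarrow> bounded_functional (\<lambda>f. S f x) M" for S M
    unfolding E_def
    using countable_jumps[OF CK_continuous[OF that(1)[OF one]]]
    by (intro small_Un small_countable few_moved_jumps[OF caught that]) auto
  have "|E (\<lambda>f. fst (T f)) \<union> E (\<lambda>f. snd (T f))| <o |UNIV :: real set|"
    by (intro small_Un small[OF T1(2,1)] small[OF T2(2,1)])
  then have "\<not> A \<subseteq> E (\<lambda>f. fst (T f)) \<union> E (\<lambda>f. snd (T f))"
    using A card_of_mono1 ordLeq_transitive not_ordLess_ordLeq by blast
  then obtain b where b: "b \<in> A" "b \<notin> E (\<lambda>f. fst (T f))" "b \<notin> E (\<lambda>f. snd (T f))" by blast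
  have diag: "\<exists>c. \<forall>f\<in>CK. jump b (S f) = c * jump b f"
    if "\<And>x. x \<in> K \<Longrightarrow> bounded_functional (\<lambda>f. S f x) M" "b \<notin> E S" for S M
  proof -
    have "bounded_functional (\<lambda>f. jump b (S f)) (2 * M)"
      unfolding bounded_functional_def
    proof (intro conjI ballI allI impI)
      note b1 = that(1)[OF A_in_K(1)[OF b(1)]] and b2 = that(1)[OF A_in_K(2)[OF b(1)]]
      fix f assume f: "f \<in> CK"
      show "jump b (S (\<lambda>x\<in>K. f x + g x)) = jump b (S f) + jump b (S g)" if "g \<in> CK" for g
        using functional_add[OF b1 CK_continuous[OF f] CK_continuous[OF that]]
          functional_add[OF b2 CK_continuous[OF f] CK_continuous[OF that]] f that
        by (simp add: jump_def)
      show "jump b (S (\<lambda>x\<in>K. c * f x)) = c * jump b (S f)" for c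
        using functional_scale[OF b1 CK_continuous[OF f]] functional_scale[OF b2 CK_continuous[OF f]] f
        by (simp add: jump_def right_diff_distrib)
      show "\<bar>jump b (S f)\<bar> \<le> 2 * M * B" if "\<forall>x\<in>K. \<bar>f x\<bar> \<le> B" for B
        using functional_bound[OF b1 CK_continuous[OF f], of B]
          functional_bound[OF b2 CK_continuous[OF f], of B] that f
        by (simp add: jump_def)
    qed
    moreover have "jump b (S (\<lambda>x\<in>K. 1)) = 0" "\<And>a. a \<in> A \<Longrightarrow> a \<noteq> b \<Longrightarrow> jump b (S (cutK a)) = 0"
      using that(2) b(1) by (auto simp: E_def one_def)
    ultimately have "\<forall>f\<in>CK. jump b (S f) = jump b (S (cutK b)) * jump b f"
      using functional_eq_jump[of "\<lambda>f. jump b (S f)" _ b] b(1) by blast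
    then show ?thesis by blast
  qed
  obtain c1 c2 where c: "\<And>f. f \<in> CK \<Longrightarrow> jump b (fst (T f)) = c1 * jump b f"
    "\<And>f. f \<in> CK \<Longrightarrow> jump b (snd (T f)) = c2 * jump b f"
    using diag[of "\<lambda>f. fst (T f)", OF T1(1) b(2)] diag[of "\<lambda>f. snd (T f)", OF T2(1) b(3)] by blast
  define u where "u = cutK b"
  define z :: "real \<Rightarrow> real" where "z = (\<lambda>x\<in>K. 0)"
  have uz: "u \<in> CK" "z \<in> CK" "jump b u = 1" "jump b z = 0"
    using cutK_CK[OF b(1)] restrict_CK[of "\<lambda>x. 0"] jump_cut[OF b(1) b(1)] A_in_K[OF b(1)]
    by (auto simp: u_def z_def jump_def)
  then have "(u, z) \<in> T ` CK" "(z, u) \<in> T ` CK" using surj by auto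
  then obtain f g where fg: "f \<in> CK" "T f = (u, z)" "g \<in> CK" "T g = (z, u)"
    by (metis imageE)
  have "c1 * jump b f = 1" "c2 * jump b f = 0" "c2 * jump b g = 1"
    using c[OF fg(1)] c[OF fg(3)] fg(2,4) uz by auto
  then show False by auto
qed

end

section \<open>The continuum and the choice of the split points\<close>

lemma real_card_eq: "|UNIV :: real set| =o ctwo ^c natLeq"
proof -
  have "|UNIV :: real set| =o |UNIV :: nat set set|"
    using nat_sets_eqpoll_reals eqpoll_sym by (auto simp: eqpoll_iff_card_of_ordIso)
  also have "|UNIV :: nat set set| =o |Func (UNIV :: nat set) (UNIV :: bool set)|"
  proof (rule card_of_ordIsoI)
    show "bij_betw (\<lambda>S n. n \<in> S) (UNIV :: nat set set) (Func UNIV UNIV)"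
      by (rule bij_betwI[where g = "\<lambda>p. {n. p n}"]) (auto simp: Func_def)
  qed
  also have "|Func (UNIV :: nat set) (UNIV :: bool set)| =o ctwo ^c natLeq"
    unfolding cexp_def ctwo_def Field_natLeq Field_card_of by (rule card_of_refl)
  finally show ?thesis .
qed

theorem corollary4p7:
  shows "\<exists>(K :: real set) (r :: real rel).
           compact_line K r \<and>
           separable_space (line_topology K r) \<and>
           has_weight (line_topology K r) (ctwo ^c natLeq) \<and>
           \<not> linearly_homeomorphic
               (C_space (line_topology K r))
               (prod_vs (C_space (line_topology K r)) (C_space (line_topology K r)))"
proof -
  define J where "J = (\<lambda>(x, y). {x<..<y} \<times> {x<..<y :: real})"
  \<comment> \<open>Besides the big sets of discontinuities, squares of intervals make \<open>A\<close> dense and of full cardinality.\<close>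
  define \<P> where "\<P> = discontinuities ` {\<kappa>. big (discontinuities \<kappa>)} \<union>
      J ` {(x, y). 0 \<le> x \<and> x < y \<and> y \<le> 1}"
  have "|discontinuities ` {\<kappa>. big (discontinuities \<kappa>)}| \<le>o |UNIV :: real set|"
    using card_of_image card_of_mono1[OF subset_UNIV] codes_le_real ordLeq_transitive by metis
  moreover have "|J ` {(x, y). 0 \<le> x \<and> x < y \<and> y \<le> 1}| \<le>o |UNIV :: real set|"
  proof -
    have "|UNIV \<times> UNIV :: (real \<times> real) set| =o |UNIV :: real set|"
      by (rule card_of_Times_same_infinite[OF infinite_real])
    then have "|UNIV :: (real \<times> real) set| \<le>o |UNIV :: real set|" by (simp add: ordIso_iff_ordLeq)
    then show ?thesis
      by (intro ordLeq_transitive[OF card_of_image ordLeq_transitive[OF card_of_mono1[OF subset_UNIV]]])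
  qed
  ultimately have card: "|\<P>| \<le>o |UNIV :: real set|"
    unfolding \<P>_def using infinite_real
    by (intro card_of_Un_ordLeq_infinite_Field card_of_Card_order) (simp_all add: Field_card_of)
  have "big P" if "P \<in> \<P>" for P using that big_square by (auto simp: \<P>_def J_def)
  from diagonal[OF card this] obtain f g
    where fg: "\<And>P. P \<in> \<P> \<Longrightarrow> (f P, g P) \<in> P" "inj_on f \<P>" "f ` \<P> \<inter> g ` \<P> = {}"
    by blast
  define A where "A = f ` \<P>"
  have J: "f (J (x, y)) \<in> A \<and> x < f (J (x, y)) \<and> f (J (x, y)) < y" if "0 \<le> x" "x < y" "y \<le> 1" for x y
  proof -
    have "J (x, y) \<in> \<P>" using that by (auto simp: \<P>_def)
    then show ?thesis using fg(1)[of "J (x, y)"] by (auto simp: A_def J_def)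
  qed
  interpret split_interval A
  proof
    have "P \<subseteq> {0<..<1} \<times> {0<..<1}" if "P \<in> \<P>" for P
      using that by (fastforce simp: \<P>_def discontinuities_def J_def)
    then show "A \<subseteq> {0<..<1}" using fg(1) unfolding A_def by blast
    show "\<exists>a\<in>A. x < a \<and> a < y" if "0 \<le> x" "x < y" "y \<le> 1" for x y using J[OF that] by blast
  qed
  have A: "|UNIV :: real set| \<le>o |A|"
  proof -
    let ?h = "\<lambda>x. f (J (x, 1))"
    have "inj_on ?h {0<..<1}"
    proof (rule inj_onI)
      fix x y :: real assume *: "x \<in> {0<..<1}" "y \<in> {0<..<1}" "?h x = ?h y"
      then have "J (x, 1) \<in> \<P>" "J (y, 1) \<in> \<P>" by (auto simp: \<P>_def)
      then have "J (x, 1) = J (y, 1)" using fg(2) *(3) by (meson inj_onD)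
      then have "{x<..<1} = {y<..<1}" using * by (auto simp: J_def times_eq_iff)
      then show "x = y" using * by (auto simp: greaterThanLessThan_eq_iff)
    qed
    then have "|{0<..<1 :: real}| \<le>o |A|" using J by (intro card_of_ordLeqI[of ?h]) auto
    then show ?thesis using interval_card[of 0 1] ordLeq_transitive by auto
  qed
  have caught: "\<exists>a b. (a, b) \<in> discontinuities \<kappa> \<and> a \<in> A \<and> b \<notin> A" if "big (discontinuities \<kappa>)" for \<kappa>
  proof -
    have "discontinuities \<kappa> \<in> \<P>" using that by (auto simp: \<P>_def)
    then show ?thesis using fg unfolding A_def by blast
  qed
  have "has_weight X (ctwo ^c natLeq)"
    using weight_X[OF A] ordIso_transitive[OF _ real_card_eq]
      ordIso_ordLeq_trans[OF ordIso_symmetric[OF real_card_eq]]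
    unfolding has_weight_def by blast
  moreover have "compact_line K ord"
    using linear_order_ord compact_X by (simp add: compact_line_def X_def)
  ultimately show ?thesis
    using separable_X not_isomorphic_to_square[OF caught A] unfolding X_def by blast
qed

end
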